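(* (Hopf's formula for Hom-Leibniz algebras.) For any Hom-Leibniz algebra $(\mathfrak g,\alpha_{\mathfrak g})$ over a field $\mathbb K$, there is an isomorphism of Hom-vector spaces $HL_2^{\alpha}(\mathfrak g)\cong\mathcal M(\mathfrak g,\alpha_{\mathfrak g})$, where for a free presentation $(\mathfrak r,\alpha_{\mathfrak r})\rightarrowtail(\mathfrak f,\alpha_{\mathfrak f})\twoheadrightarrow(\mathfrak g,\alpha_{\mathfrak g})$ the Schur multiplier is $\mathcal M(\mathfrak g,\alpha_{\mathfrak g})=(\mathfrak r\cap[\mathfrak f,\mathfrak f])/[\mathfrak f,\mathfrak r]$ with the self-map induced by $\alpha_{\mathfrak f}$.
   Context: All vector spaces and linear maps are over a fixed field $\mathbb K$. A (multiplicative) Hom-Leibniz algebra $(\mathfrak g,\alpha_{\mathfrak g})$ is a vector space $\mathfrak g$ with a bilinear product $[\,,]$ and a linear map $\alpha_{\mathfrak g}:\mathfrak g\to\mathfrak g$ such that $[\alpha_{\mathfrak g}(x),[y,z]]=[[x,y],\alpha_{\mathfrak g}(z)]-[[x,z],\alpha_{\mathfrak g}(y)]$ and $\alpha_{\mathfrak g}([x,y])=[\alpha_{\mathfrak g}(x),\alpha_{\mathfrak g}(y)]$. A Hom-vector space is a vector space with a linear self-map; homomorphisms are linear maps (preserving products, in the algebra case) commuting with the self-maps. An ideal is an $\alpha_{\mathfrak g}$-invariant subspace $\mathfrak h$ with $[\mathfrak h,\mathfrak g],[\mathfrak g,\mathfrak h]\subseteq\mathfrak h$. For ideals $\mathfrak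 h,\mathfrak k$, $[\mathfrak h,\mathfrak k]$ is the subalgebra generated by all $[h,k]$ and $[k,h]$, $h\in\mathfrak h,k\in\mathfrak k$. A Hom-Leibniz algebra $(\mathfrak f,\alpha_{\mathfrak f})$ is free over a Hom-vector space $(\mathfrak v,\alpha_{\mathfrak v})$ if it comes with a homomorphism of Hom-vector spaces $\mathfrak v\to\mathfrak f$ through which every homomorphism of Hom-vector spaces from $\mathfrak v$ to a Hom-Leibniz algebra factors by a unique homomorphism of Hom-Leibniz algebras. A free presentation of $\mathfrak g$ is a short exact sequence $\mathfrak r\rightarrowtail\mathfrak f\twoheadrightarrow\mathfrak g$ of Hom-Leibniz algebras with $\mathfrak f$ free (over some Hom-vector space); every Hom-Leibniz algebra has one and $\mathcal M(\mathfrak g,\alpha_{\mathfrak g})$ does not depend on it up to isomorphism. Homology: let $CL_n^\alpha(\mathfrak g)=(\mathfrak g^{\otimes n},\alpha_{\mathfrak g}^{\otimes n})$ with $$d_n(x_1\otimes\dots\otimes x_n)=\sum_{1\le i<j\le n}(-1)^{j+1}\alpha_{\mathfrak g}(x_1)\otimes\dots\otimes\alpha_{\mathfrak g}(x_{i-1})\otimes[x_i,x_j]\otimes\alpha_{\mathfrak g}(x_{i+1})\otimes\dots\otimes\widehat{\alpha_{\mathfrak g}(x_j)}\otimes\dots\otimes\alpha_{\mathfrak g}(x_n)$$ (hat means omitted). Then $HL_n^\alpha(\mathfrak g)=\ker(d_n)/\mathrm{Im}(d_{n+1})$ with the self-map induced by $\alpha_{\mathfrak g}^{\otimes n}$. 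*)

theory Defs
  imports "HOL-Algebra.Module" "HOL-Algebra.AbelCoset"
begin

section \<open>Hom-vector spaces and Hom-Leibniz algebras\<close>

text \<open>
  The record \<open>module\<close> extends \<open>ring\<close>; its fields \<open>mult\<close> and \<open>one\<close> are ignored by the locale
  \<open>module\<close> and play no role below.  Products of algebras are given by the separate field
  \<open>bracket\<close>.
\<close>

record ('k, 'a) hom_module = "('k, 'a) module" +
  twist :: "'a \<Rightarrow> 'a"

record ('k, 'a) hom_algebra = "('k, 'a) hom_module" +
  bracket :: "'a \<Rightarrow> 'a \<Rightarrow> 'a"

definition linear_maps ::
    "('k, 'm) ring_scheme \<Rightarrow> ('k, 'a, 'x) module_scheme \<Rightarrow> ('k, 'b, 'y) module_scheme \<Rightarrow> ('a \<Rightarrow> 'b) set"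
  where "linear_maps K A B =
    {f \<in> carrier A \<rightarrow> carrier B.
       (\<forall>x \<in> carrier A. \<forall>y \<in> carrier A. f (x \<oplus>\<^bsub>A\<^esub> y) = f x \<oplus>\<^bsub>B\<^esub> f y) \<and>
       (\<forall>a \<in> carrier K. \<forall>x \<in> carrier A. f (a \<odot>\<^bsub>A\<^esub> x) = a \<odot>\<^bsub>B\<^esub> f x)}"

locale hom_vector_space = field K + module K V
  for K (structure) and V :: "('k, 'a, 'x) hom_module_scheme" (structure) +
  assumes twist_linear: "twist V \<in> linear_maps K V V"

locale hom_leibniz_algebra = hom_vector_space K G
  for K (structure) and G :: "('k, 'a, 'x) hom_algebra_scheme" (structure) +
  assumes bracket_linear_left: "y \<in> carrier G \<Longrightarrow> (\<lambda>x. bracket G x y) \<in> linear_maps K G G"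
    and bracket_linear_right: "x \<in> carrier G \<Longrightarrow> bracket G x \<in> linear_maps K G G"
    and hom_leibniz_identity:
      "\<lbrakk>x \<in> carrier G; y \<in> carrier G; z \<in> carrier G\<rbrakk> \<Longrightarrow>
         bracket G (twist G x) (bracket G y z) =
           bracket G (bracket G x y) (twist G z) \<ominus>\<^bsub>G\<^esub> bracket G (bracket G x z) (twist G y)"
    and twist_bracket:
      "\<lbrakk>x \<in> carrier G; y \<in> carrier G\<rbrakk> \<Longrightarrow>
         twist G (bracket G x y) = bracket G (twist G x) (twist G y)"

definition hom_space_homs ::
    "('k, 'm) ring_scheme \<Rightarrow> ('k, 'a, 'x) hom_module_scheme \<Rightarrow> ('k, 'b, 'y) hom_module_scheme \<Rightarrow>
      ('a \<Rightarrow> 'b) set"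
  where "hom_space_homs K A B =
    {f \<in> linear_maps K A B. \<forall>x \<in> carrier A. f (twist A x) = twist B (f x)}"

definition hom_leibniz_homs ::
    "('k, 'm) ring_scheme \<Rightarrow> ('k, 'a, 'x) hom_algebra_scheme \<Rightarrow> ('k, 'b, 'y) hom_algebra_scheme \<Rightarrow>
      ('a \<Rightarrow> 'b) set"
  where "hom_leibniz_homs K A B =
    {f \<in> hom_space_homs K A B.
       \<forall>x \<in> carrier A. \<forall>y \<in> carrier A. f (bracket A x y) = bracket B (f x) (f y)}"

definition hom_space_iso ::
    "('k, 'm) ring_scheme \<Rightarrow> ('k, 'a, 'x) hom_module_scheme \<Rightarrow> ('k, 'b, 'y) hom_module_scheme \<Rightarrow> bool"
  where "hom_space_iso K A B \<longleftrightarrow>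
    hom_vector_space K A \<and> hom_vector_space K B \<and>
    (\<exists>f \<in> hom_space_homs K A B. bij_betw f (carrier A) (carrier B))"

definition hom_subalgebra ::
    "('k, 'm) ring_scheme \<Rightarrow> ('k, 'a, 'x) hom_algebra_scheme \<Rightarrow> 'a set \<Rightarrow> bool"
  where "hom_subalgebra K G S \<longleftrightarrow>
    submodule S K G \<and> (\<forall>x \<in> S. twist G x \<in> S) \<and> (\<forall>x \<in> S. \<forall>y \<in> S. bracket G x y \<in> S)"

definition commutator ::
    "('k, 'm) ring_scheme \<Rightarrow> ('k, 'a, 'x) hom_algebra_scheme \<Rightarrow> 'a set \<Rightarrow> 'a set \<Rightarrow> 'a set"
  where "commutator K G H L =
    \<Inter> {S. hom_subalgebra K G S \<and> (\<forall>h \<in> H. \<forall>l \<in> L. bracket G h l \<in> S \<and> bracket G l h \<in> S)}"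


section \<open>Quotients\<close>

text \<open>
  Maps out of a quotient are written \<open>\<lambda>X. the_elem (f ` X)\<close>, the common value of \<open>f\<close> on the
  coset \<open>X\<close>, as for \<open>FactGroup\<close> in the library.
\<close>

definition quot_module ::
    "('k, 'a, 'x) module_scheme \<Rightarrow> 'a set \<Rightarrow> ('k, 'a set) module"
  where "quot_module M N =
    \<lparr>carrier = a_rcosets\<^bsub>M\<^esub> N, mult = undefined, one = undefined,
     zero = N, add = set_add M,
     smult = (\<lambda>a X. the_elem ((\<lambda>x. N +>\<^bsub>M\<^esub> (a \<odot>\<^bsub>M\<^esub> x)) ` X))\<rparr>"

definition with_twist :: "('k, 'a) module \<Rightarrow> ('a \<Rightarrow> 'a) \<Rightarrow> ('k, 'a) hom_module"
  where "with_twist M t = module.extend M (hom_module.fields t)"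

definition quot_hom_space ::
    "('k, 'a, 'x) hom_module_scheme \<Rightarrow> 'a set \<Rightarrow> ('k, 'a set) hom_module"
  where "quot_hom_space V N =
    with_twist (quot_module V N) (\<lambda>X. the_elem ((\<lambda>x. N +>\<^bsub>V\<^esub> twist V x) ` X))"


section \<open>Tensor powers\<close>

text \<open>
  The \<open>n\<close>-th tensor power of \<open>M\<close> is the vector space with basis the \<open>n\<close>-tuples over \<open>M\<close>
  (lists of length \<open>n\<close>) modulo the multilinearity relations.
\<close>

definition free_module :: "('k, 'm) ring_scheme \<Rightarrow> 'x set \<Rightarrow> ('k, 'x \<Rightarrow> 'k) module"
  where "free_module K B =
    \<lparr>carrier = {u. range u \<subseteq> carrier K \<and> finite {x. u x \<noteq> \<zero>\<^bsub>K\<^esub>} \<and> {x. u x \<noteq> \<zero>\<^bsub>K\<^esub>} \<subseteq> B},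
     mult = undefined, one = undefined,
     zero = (\<lambda>x. \<zero>\<^bsub>K\<^esub>), add = (\<lambda>u v x. u x \<oplus>\<^bsub>K\<^esub> v x),
     smult = (\<lambda>a u x. a \<otimes>\<^bsub>K\<^esub> u x)\<rparr>"

definition basis_vec :: "('k, 'm) ring_scheme \<Rightarrow> 'x \<Rightarrow> 'x \<Rightarrow> 'k"
  where "basis_vec K x = (\<lambda>y. if y = x then \<one>\<^bsub>K\<^esub> else \<zero>\<^bsub>K\<^esub>)"

definition linear_extension ::
    "('k, 'm) ring_scheme \<Rightarrow> ('k, 'b, 'y) module_scheme \<Rightarrow> ('x \<Rightarrow> 'b) \<Rightarrow> ('x \<Rightarrow> 'k) \<Rightarrow> 'b"
  where "linear_extension K N f u = (\<Oplus>\<^bsub>N\<^esub>x\<in>{x. u x \<noteq> \<zero>\<^bsub>K\<^esub>}. u x \<odot>\<^bsub>N\<^esub> f x)"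

definition linear_span ::
    "('k, 'm) ring_scheme \<Rightarrow> ('k, 'a, 'x) module_scheme \<Rightarrow> 'a set \<Rightarrow> 'a set"
  where "linear_span K M S = \<Inter> {N. submodule N K M \<and> S \<subseteq> N}"

definition tuples :: "('k, 'a, 'x) module_scheme \<Rightarrow> nat \<Rightarrow> 'a list set"
  where "tuples M n = {xs. length xs = n \<and> set xs \<subseteq> carrier M}"

definition multilinear_rels ::
    "('k, 'm) ring_scheme \<Rightarrow> ('k, 'a, 'x) module_scheme \<Rightarrow> nat \<Rightarrow> ('a list \<Rightarrow> 'k) set"
  where "multilinear_rels K M n =
    (let T = free_module K (tuples M n); e = basis_vec K in
      {e (xs[i := x \<oplus>\<^bsub>M\<^esub> y]) \<ominus>\<^bsub>T\<^esub> (e (xs[i := x]) \<oplus>\<^bsub>T\<^esub> e (xs[i := y])) | xs i x y.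
         xs \<in> tuples M n \<and> i < n \<and> x \<in> carrier M \<and> y \<in> carrier M} \<union>
      {e (xs[i := a \<odot>\<^bsub>M\<^esub> x]) \<ominus>\<^bsub>T\<^esub> (a \<odot>\<^bsub>T\<^esub> e (xs[i := x])) | xs i a x.
         xs \<in> tuples M n \<and> i < n \<and> a \<in> carrier K \<and> x \<in> carrier M})"

definition tensor_null ::
    "('k, 'm) ring_scheme \<Rightarrow> ('k, 'a, 'x) module_scheme \<Rightarrow> nat \<Rightarrow> ('a list \<Rightarrow> 'k) set"
  where "tensor_null K M n =
    linear_span K (free_module K (tuples M n)) (multilinear_rels K M n)"

definition tensor_power ::
    "('k, 'm) ring_scheme \<Rightarrow> ('k, 'a, 'x) module_scheme \<Rightarrow> nat \<Rightarrow> ('k, ('a list \<Rightarrow> 'k) set) module"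
  where "tensor_power K M n = quot_module (free_module K (tuples M n)) (tensor_null K M n)"

text \<open>The pure tensor \<open>x\<^sub>1 \<otimes> \<dots> \<otimes> x\<^sub>n\<close> of a tuple.\<close>

definition pure_tensor ::
    "('k, 'm) ring_scheme \<Rightarrow> ('k, 'a, 'x) module_scheme \<Rightarrow> 'a list \<Rightarrow> ('a list \<Rightarrow> 'k) set"
  where "pure_tensor K M xs =
    tensor_null K M (length xs) +>\<^bsub>free_module K (tuples M (length xs))\<^esub> basis_vec K xs"

text \<open>
  The linear map from a tensor power to \<open>N\<close> which sends the pure tensor of \<open>xs\<close> to \<open>f xs\<close>, for
  multilinear \<open>f\<close>.
\<close>

definition tensor_lift ::
    "('k, 'm) ring_scheme \<Rightarrow> ('k, 'b, 'y) module_scheme \<Rightarrow> ('a list \<Rightarrow> 'b) \<Rightarrow>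
      ('a list \<Rightarrow> 'k) set \<Rightarrow> 'b"
  where "tensor_lift K N f X = the_elem (linear_extension K N f ` X)"


section \<open>Homology\<close>

definition CL ::
    "('k, 'm) ring_scheme \<Rightarrow> ('k, 'a, 'x) hom_algebra_scheme \<Rightarrow> nat \<Rightarrow>
      ('k, ('a list \<Rightarrow> 'k) set) hom_module"
  where "CL K G n =
    with_twist (tensor_power K G n)
      (tensor_lift K (tensor_power K G n) (\<lambda>xs. pure_tensor K G (map (twist G) xs)))"

text \<open>
  Positions in a list are counted from 0: the pair \<open>i < j\<close> below is the pair \<open>i + 1 < j + 1\<close> of
  positions counted from 1, so that the sign \<open>(-1)\<^sup>j\<^sup>+\<^sup>1\<close> of the usual formula becomes
  \<open>(-1)\<^sup>j\<^sup>+\<^sup>2 = (-1)\<^sup>j\<close>.  The map \<open>CL_d K G n\<close> goes from \<open>CL K G n\<close> to \<open>CL K G (n - 1)\<close>; for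
  \<open>n \<le> 1\<close> it is zero.
\<close>

definition CL_face :: "('k, 'a, 'x) hom_algebra_scheme \<Rightarrow> nat \<Rightarrow> nat \<Rightarrow> 'a list \<Rightarrow> 'a list"
  where "CL_face G i j xs =
    (let ys = (map (twist G) xs)[i := bracket G (xs ! i) (xs ! j)] in take j ys @ drop (Suc j) ys)"

definition CL_d ::
    "('k, 'm) ring_scheme \<Rightarrow> ('k, 'a, 'x) hom_algebra_scheme \<Rightarrow> nat \<Rightarrow>
      ('a list \<Rightarrow> 'k) set \<Rightarrow> ('a list \<Rightarrow> 'k) set"
  where "CL_d K G n =
    (let N = tensor_power K G (n - 1) in
      tensor_lift K N
        (\<lambda>xs. \<Oplus>\<^bsub>N\<^esub>p\<in>{(i, j). i < j \<and> j < n}.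
           ((\<ominus>\<^bsub>K\<^esub> \<one>\<^bsub>K\<^esub>) [^]\<^bsub>K\<^esub> snd p) \<odot>\<^bsub>N\<^esub> pure_tensor K G (CL_face G (fst p) (snd p) xs)))"

definition HL ::
    "('k, 'm) ring_scheme \<Rightarrow> ('k, 'a, 'x) hom_algebra_scheme \<Rightarrow> nat \<Rightarrow>
      ('k, ('a list \<Rightarrow> 'k) set set) hom_module"
  where "HL K G n =
    quot_hom_space
      ((CL K G n)\<lparr>carrier := a_kernel (CL K G n) (CL K G (n - 1)) (CL_d K G n)\<rparr>)
      (CL_d K G (Suc n) ` carrier (CL K G (Suc n)))"


section \<open>Free presentations and the Schur multiplier\<close>

text \<open>
  Since one cannot quantify over types, the universal property is stated for Hom-Leibniz algebras
  whose carrier is a subset of the type \<open>('k + 'v + 'f) list\<close>, where \<open>'k\<close>, \<open>'v\<close>, \<open>'f\<close> are the types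
  of the field, of the Hom-vector space \<open>V\<close> and of \<open>F\<close>.  This implies the universal property for
  Hom-Leibniz algebras \<open>H\<close> over any type.  Existence: the subalgebra of \<open>H\<close> generated by the
  image of \<open>V\<close> is spanned by iterated brackets and twists of elements of the image, so it injects
  into \<open>('k + 'v + 'f) list\<close> and has an isomorphic copy there.  Uniqueness: \<open>F\<close> itself has a copy in
  this type; existence for the subalgebra of \<open>F\<close> generated by \<open>i ` carrier V\<close> and uniqueness for \<open>F\<close>
  show that \<open>F\<close> is generated by \<open>i ` carrier V\<close>.
\<close>

definition free_hom_leibniz ::
    "('k, 'm) ring_scheme \<Rightarrow> ('k, 'v) hom_module \<Rightarrow> ('v \<Rightarrow> 'f) \<Rightarrow> ('k, 'f) hom_algebra \<Rightarrow> bool"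
  where "free_hom_leibniz K V i F \<longleftrightarrow>
    hom_vector_space K V \<and> hom_leibniz_algebra K F \<and> i \<in> hom_space_homs K V F \<and>
    (\<forall>(H :: ('k, ('k + 'v + 'f) list) hom_algebra) \<phi>.
       hom_leibniz_algebra K H \<longrightarrow> \<phi> \<in> hom_space_homs K V H \<longrightarrow>
       (\<exists>\<psi> \<in> hom_leibniz_homs K F H.
          (\<forall>v \<in> carrier V. \<psi> (i v) = \<phi> v) \<and>
          (\<forall>\<psi>' \<in> hom_leibniz_homs K F H.
             (\<forall>v \<in> carrier V. \<psi>' (i v) = \<phi> v) \<longrightarrow> (\<forall>x \<in> carrier F. \<psi>' x = \<psi> x))))"

definition short_exact ::
    "('k, 'm) ring_scheme \<Rightarrow> ('k, 'r) hom_algebra \<Rightarrow> ('r \<Rightarrow> 'f) \<Rightarrow> ('k, 'f) hom_algebra \<Rightarrow>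
      ('f \<Rightarrow> 'g) \<Rightarrow> ('k, 'g) hom_algebra \<Rightarrow> bool"
  where "short_exact K R \<iota> F \<pi> G \<longleftrightarrow>
    hom_leibniz_algebra K R \<and> hom_leibniz_algebra K F \<and> hom_leibniz_algebra K G \<and>
    \<iota> \<in> hom_leibniz_homs K R F \<and> \<pi> \<in> hom_leibniz_homs K F G \<and>
    inj_on \<iota> (carrier R) \<and> \<iota> ` carrier R = a_kernel F G \<pi> \<and> \<pi> ` carrier F = carrier G"

definition free_presentation ::
    "('k, 'm) ring_scheme \<Rightarrow> ('k, 'v) hom_module \<Rightarrow> ('v \<Rightarrow> 'f) \<Rightarrow>
      ('k, 'r) hom_algebra \<Rightarrow> ('r \<Rightarrow> 'f) \<Rightarrow> ('k, 'f) hom_algebra \<Rightarrow>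
      ('f \<Rightarrow> 'g) \<Rightarrow> ('k, 'g) hom_algebra \<Rightarrow> bool"
  where "free_presentation K V i R \<iota> F \<pi> G \<longleftrightarrow>
    free_hom_leibniz K V i F \<and> short_exact K R \<iota> F \<pi> G"

text \<open>The argument \<open>I\<close> is the ideal of \<open>F\<close> with quotient \<open>G\<close>, i.e. the image of \<open>\<iota>\<close>.\<close>

definition schur_multiplier ::
    "('k, 'm) ring_scheme \<Rightarrow> ('k, 'f) hom_algebra \<Rightarrow> 'f set \<Rightarrow> ('k, 'f set) hom_module"
  where "schur_multiplier K F I =
    quot_hom_space
      (F\<lparr>carrier := I \<inter> commutator K F (carrier F) (carrier F)\<rparr>)
      (commutator K F (carrier F) I)"

end

theory Submission
  imports Defs
begin

text \<open>
  Write \<open>d\<^sub>n\<close> for the differentials of \<open>G\<close> and let \<open>Q\<close> be the quotient of \<open>G \<otimes> G\<close> by the image of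
  \<open>d\<^sub>3\<close>, with \<open>x \<circ> y\<close> for the class of \<open>x \<otimes> y\<close>.  The formula for \<open>d\<^sub>3\<close> says that \<open>(x, y) \<mapsto> x \<circ> y\<close> is
  the universal bilinear map with \<open>\<alpha> x \<circ> [y, z] = [x, y] \<circ> \<alpha> z - [x, z] \<circ> \<alpha> y\<close>; bilinear maps
  with this property are called Leibniz pairings below (\<open>leibniz_square_lift\<close>).  The bracket of
  \<open>G\<close> is a Leibniz pairing, so it induces a linear map \<open>\<mu>\<close> from \<open>Q\<close> to \<open>G\<close>.  Since \<open>d\<^sub>2\<close> is \<open>- \<mu>\<close>
  up to the identification of \<open>G\<close> with its first tensor power, \<open>HL\<^sub>2\<close> is the kernel of \<open>\<mu>\<close>
  (\<open>HL_2_eq\<close>).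

  Let \<open>\<pi>\<close> be the surjection from the free algebra \<open>F\<close> to \<open>G\<close>, \<open>I\<close> its kernel, \<open>B = [F, F]\<close> and
  \<open>C = [F, I]\<close>.  The proof compares \<open>B\<close> with \<open>Q\<close> by maps in both directions.

  From \<open>B\<close> to \<open>Q\<close>: the defining identity of a Leibniz pairing is exactly what makes \<open>G \<oplus> Q\<close> a
  Hom-Leibniz algebra under \<open>[(x, q), (y, r)] = ([x, y], x \<circ> y)\<close> (\<open>extension\<close>).  As \<open>F\<close> is free, the
  map \<open>v \<mapsto> (\<pi> (i v), 0)\<close> extends to a homomorphism from \<open>F\<close> to \<open>G \<oplus> Q\<close>, whose first component
  agrees with \<open>\<pi>\<close> on generators and therefore equals \<open>\<pi>\<close>.  Its second component \<open>\<rho>\<close> is linear,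
  commutes with the twists and satisfies \<open>\<rho> [x, y] = \<pi> x \<circ> \<pi> y\<close> (\<open>lift_to_leibniz_square\<close>).  Hence
  \<open>\<rho>\<close> maps \<open>B\<close> onto \<open>Q\<close>, vanishes on \<open>C\<close>, and \<open>\<mu> (\<rho> b) = \<pi> b\<close> for \<open>b \<in> B\<close>.

  From \<open>Q\<close> to \<open>F / C\<close>: the class of \<open>[x, y]\<close> modulo \<open>C\<close> depends only on \<open>\<pi> x\<close> and \<open>\<pi> y\<close>, and it is
  a Leibniz pairing of these (\<open>coset_pairing\<close>).  The induced linear map \<open>\<theta>\<close> satisfies
  \<open>\<theta> (\<rho> b) = b + C\<close> for \<open>b \<in> B\<close>, so the kernel of \<open>\<rho>\<close> on \<open>B\<close> is exactly \<open>C\<close>.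

  Restricted to \<open>I \<inter> B\<close>, the map \<open>\<rho>\<close> is thus a surjection onto the kernel of \<open>\<mu>\<close>, that is onto
  \<open>HL\<^sub>2\<close>, with the same kernel \<open>C\<close> as the projection onto \<open>(I \<inter> B) / C\<close>.
\<close>


section \<open>Linear maps and submodules\<close>

lemma (in abelian_group) minus_eq_zero_iff:
  assumes "x \<in> carrier G" "y \<in> carrier G"
  shows "x \<ominus> y = \<zero> \<longleftrightarrow> x = y"
  using assms minus_equality[of x "\<ominus> y"] by (auto simp: a_minus_def r_neg)

lemma (in abelian_group) neg_add_add_eq_zero_iff:
  assumes "a \<in> carrier G" "b \<in> carrier G" "c \<in> carrier G"
  shows "\<ominus> a \<oplus> (b \<oplus> c) = \<zero> \<longleftrightarrow> c = a \<ominus> b"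
proof -
  have "\<ominus> a \<oplus> (b \<oplus> c) = c \<ominus> (a \<ominus> b)"
    using assms by (simp add: a_minus_def minus_add a_ac)
  then show ?thesis using assms minus_eq_zero_iff[of c "a \<ominus> b"] by simp
qed

lemma linear_mapsI:
  assumes "\<And>x. x \<in> carrier A \<Longrightarrow> f x \<in> carrier B"
    and "\<And>x y. \<lbrakk>x \<in> carrier A; y \<in> carrier A\<rbrakk> \<Longrightarrow> f (x \<oplus>\<^bsub>A\<^esub> y) = f x \<oplus>\<^bsub>B\<^esub> f y"
    and "\<And>a x. \<lbrakk>a \<in> carrier K; x \<in> carrier A\<rbrakk> \<Longrightarrow> f (a \<odot>\<^bsub>A\<^esub> x) = a \<odot>\<^bsub>B\<^esub> f x"
  shows "f \<in> linear_maps K A B"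
  using assms by (auto simp: linear_maps_def)

lemma linear_mapsD:
  assumes "f \<in> linear_maps K A B"
  shows "x \<in> carrier A \<Longrightarrow> f x \<in> carrier B"
    and "\<lbrakk>x \<in> carrier A; y \<in> carrier A\<rbrakk> \<Longrightarrow> f (x \<oplus>\<^bsub>A\<^esub> y) = f x \<oplus>\<^bsub>B\<^esub> f y"
    and "\<lbrakk>a \<in> carrier K; x \<in> carrier A\<rbrakk> \<Longrightarrow> f (a \<odot>\<^bsub>A\<^esub> x) = a \<odot>\<^bsub>B\<^esub> f x"
  using assms by (auto simp: linear_maps_def)

lemma linear_maps_comp:
  "\<lbrakk>f \<in> linear_maps K A B; g \<in> linear_maps K B C\<rbrakk> \<Longrightarrow> (\<lambda>x. g (f x)) \<in> linear_maps K A C"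
  by (auto simp: linear_maps_def Pi_iff)

locale linear_map = dom: module K A + cod: module K B
  for K (structure) and A :: "('k, 'a, 'x) module_scheme" and B :: "('k, 'b, 'y) module_scheme" +
  fixes f
  assumes linear: "f \<in> linear_maps K A B"
begin

lemmas closed = linear_mapsD(1)[OF linear]
  and add = linear_mapsD(2)[OF linear]
  and smult = linear_mapsD(3)[OF linear]

sublocale abelian_group_hom A B f
proof (rule abelian_group_homI)
  show "group_hom (add_monoid A) (add_monoid B) f"
    by (rule group_hom.intro[OF dom.a_group cod.a_group])
      (auto simp: group_hom_axioms_def hom_def closed add)
qed (rule dom.abelian_group_axioms cod.abelian_group_axioms)+

lemma minus: "\<lbrakk>x \<in> carrier A; y \<in> carrier A\<rbrakk> \<Longrightarrow> f (x \<ominus>\<^bsub>A\<^esub> y) = f x \<ominus>\<^bsub>B\<^esub> f y"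
  by (simp add: a_minus_def)

lemma submodule_vimage:
  assumes "submodule N K B"
  shows "submodule {x \<in> carrier A. f x \<in> N} K A"
proof -
  interpret N: submodule N K B by fact
  show ?thesis
    using N.one_closed
    by (intro dom.submoduleI) (auto simp: smult intro: cod.submoduleE(3-5)[OF assms])
qed

lemma submodule_image:
  assumes "submodule N K A"
  shows "submodule (f ` N) K B"
proof -
  interpret N: submodule N K A by fact
  have sub: "N \<subseteq> carrier A" by (rule dom.submoduleE[OF assms])
  show ?thesis
  proof (intro cod.submoduleI)
    show "f ` N \<subseteq> carrier B" using sub by auto
    show "\<zero>\<^bsub>B\<^esub> \<in> f ` N"
      by (rule image_eqI[of _ _ "\<zero>\<^bsub>A\<^esub>"]) (use N.one_closed in auto)
  next
    fix y assume "y \<in> f ` N"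
    then obtain x where "x \<in> N" "y = f x" by auto
    then show "\<ominus>\<^bsub>B\<^esub> y \<in> f ` N"
      by (intro image_eqI[of _ _ "\<ominus>\<^bsub>A\<^esub> x"]) (use sub in \<open>auto intro: dom.submoduleE(3-5)[OF assms]\<close>)
  next
    fix y z assume "y \<in> f ` N" "z \<in> f ` N"
    then obtain x x' where "x \<in> N" "y = f x" "x' \<in> N" "z = f x'" by auto
    then show "y \<oplus>\<^bsub>B\<^esub> z \<in> f ` N"
      by (intro image_eqI[of _ _ "x \<oplus>\<^bsub>A\<^esub> x'"])
        (use sub in \<open>auto simp: subsetD[OF sub] intro: dom.submoduleE(3-5)[OF assms]\<close>)
  next
    fix a y assume "a \<in> carrier K" "y \<in> f ` N"
    then obtain x where "x \<in> N" "y = f x" by auto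
    then show "a \<odot>\<^bsub>B\<^esub> y \<in> f ` N" using \<open>a \<in> carrier K\<close>
      by (intro image_eqI[of _ _ "a \<odot>\<^bsub>A\<^esub> x"]) (use sub smult in auto)
  qed
qed

end

lemma linear_mapI:
  "\<lbrakk>module K A; module K B; f \<in> linear_maps K A B\<rbrakk> \<Longrightarrow> linear_map K A B f"
  by (simp add: linear_map_def linear_map_axioms_def)

lemma linear_maps_zero:
  "\<lbrakk>f \<in> linear_maps K A B; module K A; module K B\<rbrakk> \<Longrightarrow> f \<zero>\<^bsub>A\<^esub> = \<zero>\<^bsub>B\<^esub>"
proof -
  assume "f \<in> linear_maps K A B" "module K A" "module K B"
  then interpret linear_map K A B f by (intro linear_mapI)
  show ?thesis by (rule hom_zero)
qed

lemma submodule_equalizer: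
  assumes "linear_map K A B f" and "linear_map K A B g"
  shows "submodule {x \<in> carrier A. f x = g x} K A"
proof -
  interpret f: linear_map K A B f by fact
  interpret g: linear_map K A B g by fact
  show ?thesis
    by (intro f.dom.submoduleI) (auto simp: f.smult g.smult)
qed

context module
begin

lemma smult_linear: "a \<in> carrier R \<Longrightarrow> (\<lambda>x. a \<odot>\<^bsub>M\<^esub> x) \<in> linear_maps R M M"
  by (rule linear_mapsI) (auto simp: smult_r_distr smult_assoc1[symmetric] m_comm)

lemma submodule_zero: "submodule {\<zero>\<^bsub>M\<^esub>} R M"
  by (intro submoduleI) auto

lemma submodule_Int:
  assumes "submodule N R M" "submodule L R M"
  shows "submodule (N \<inter> L) R M"
proof -
  interpret N: submodule N R M by fact
  interpret L: submodule L R M by fact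
  show ?thesis
    using N.one_closed L.one_closed N.subset
    by (intro submoduleI) (auto intro: submoduleE(3-5)[OF assms(1)] submoduleE(3-5)[OF assms(2)])
qed

lemma linear_span_submodule:
  assumes "S \<subseteq> carrier M"
  shows "submodule (linear_span R M S) R M"
proof -
  have sub: "submodule N R M \<Longrightarrow> \<zero>\<^bsub>M\<^esub> \<in> N" for N
    using submodule.axioms(1)[of N R M] subgroup.one_closed[of N "add_monoid M"] by auto
  show ?thesis
    unfolding linear_span_def
  proof (intro submoduleI)
    show "\<Inter> {N. submodule N R M \<and> S \<subseteq> N} \<subseteq> carrier M"
      using carrier_is_submodule assms by auto
  qed (use sub in \<open>auto intro: submoduleE(3-5)\<close>)
qed

lemma linear_span_superset: "S \<subseteq> linear_span R M S"
  by (auto simp: linear_span_def)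

lemma linear_span_minimal:
  "\<lbrakk>submodule N R M; S \<subseteq> N\<rbrakk> \<Longrightarrow> linear_span R M S \<subseteq> N"
  by (auto simp: linear_span_def)

end

lemma linear_maps_smult:
  assumes "module K B" "f \<in> linear_maps K A B" "c \<in> carrier K"
  shows "(\<lambda>x. c \<odot>\<^bsub>B\<^esub> f x) \<in> linear_maps K A B"
proof -
  interpret B: module K B by fact
  show ?thesis by (rule linear_maps_comp[OF assms(2) B.smult_linear[OF assms(3)]])
qed

lemma linear_maps_finsum:
  assumes "module K B" and P: "finite P" and h: "\<And>p. p \<in> P \<Longrightarrow> h p \<in> linear_maps K A B"
  shows "(\<lambda>x. \<Oplus>\<^bsub>B\<^esub>p\<in>P. h p x) \<in> linear_maps K A B"
proof -
  interpret B: module K B by fact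
  note hD = linear_mapsD[OF h]
  show ?thesis
  proof (rule linear_mapsI)
    fix x assume x: "x \<in> carrier A"
    show "(\<Oplus>\<^bsub>B\<^esub>p\<in>P. h p x) \<in> carrier B" using x hD(1) by (intro B.M.finsum_closed) auto
    {
      fix y assume y: "y \<in> carrier A"
      have "(\<Oplus>\<^bsub>B\<^esub>p\<in>P. h p (x \<oplus>\<^bsub>A\<^esub> y)) = (\<Oplus>\<^bsub>B\<^esub>p\<in>P. h p x \<oplus>\<^bsub>B\<^esub> h p y)"
        by (rule B.M.add.finprod_cong') (use x y hD in auto)
      also have "\<dots> = (\<Oplus>\<^bsub>B\<^esub>p\<in>P. h p x) \<oplus>\<^bsub>B\<^esub> (\<Oplus>\<^bsub>B\<^esub>p\<in>P. h p y)"
        by (rule B.M.finsum_addf) (use x y hD in auto)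
      finally show "(\<Oplus>\<^bsub>B\<^esub>p\<in>P. h p (x \<oplus>\<^bsub>A\<^esub> y)) = (\<Oplus>\<^bsub>B\<^esub>p\<in>P. h p x) \<oplus>\<^bsub>B\<^esub> (\<Oplus>\<^bsub>B\<^esub>p\<in>P. h p y)" .
    }
    {
      fix a assume a: "a \<in> carrier K"
      have "(\<Oplus>\<^bsub>B\<^esub>p\<in>P. h p (a \<odot>\<^bsub>A\<^esub> x)) = (\<Oplus>\<^bsub>B\<^esub>p\<in>P. a \<odot>\<^bsub>B\<^esub> h p x)"
        by (rule B.M.add.finprod_cong') (use x a hD in auto)
      also have "\<dots> = a \<odot>\<^bsub>B\<^esub> (\<Oplus>\<^bsub>B\<^esub>p\<in>P. h p x)"
        by (rule B.finsum_smult_ldistr[symmetric]) (use x a hD P in auto)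
      finally show "(\<Oplus>\<^bsub>B\<^esub>p\<in>P. h p (a \<odot>\<^bsub>A\<^esub> x)) = a \<odot>\<^bsub>B\<^esub> (\<Oplus>\<^bsub>B\<^esub>p\<in>P. h p x)" .
    }
  qed
qed

lemma (in linear_map) map_finsum:
  assumes "finite P" "\<And>p. p \<in> P \<Longrightarrow> g p \<in> carrier A"
  shows "f (\<Oplus>\<^bsub>A\<^esub>p\<in>P. g p) = (\<Oplus>\<^bsub>B\<^esub>p\<in>P. f (g p))"
  using assms by (induction P rule: finite_induct) (simp_all add: Pi_iff closed)

lemma linear_maps_eq_on_span:
  assumes "linear_map K A B f" "linear_map K A B g" "S \<subseteq> carrier A"
    and "\<And>x. x \<in> S \<Longrightarrow> f x = g x" and "x \<in> linear_span K A S"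
  shows "f x = g x"
proof -
  interpret f: linear_map K A B f by fact
  have "linear_span K A S \<subseteq> {x \<in> carrier A. f x = g x}"
    by (rule f.dom.linear_span_minimal[OF submodule_equalizer[OF assms(1,2)]])
      (use assms in auto)
  with assms(5) show ?thesis by auto
qed

text \<open>
  Every law of a module is an equation or the existence of an additive inverse, so it passes to
  images.  Quotients and transported structures are modules by this lemma.
\<close>
lemma module_image:
  assumes "module K A" and surj: "p ` carrier A = carrier B"
    and zero: "p \<zero>\<^bsub>A\<^esub> = \<zero>\<^bsub>B\<^esub>"
    and add: "\<And>x y. \<lbrakk>x \<in> carrier A; y \<in> carrier A\<rbrakk> \<Longrightarrow> p (x \<oplus>\<^bsub>A\<^esub> y) = p x \<oplus>\<^bsub>B\<^esub> p y"
    and smult: "\<And>a x. \<lbrakk>a \<in> carrier K; x \<in> carrier A\<rbrakk> \<Longrightarrow> p (a \<odot>\<^bsub>A\<^esub> x) = a \<odot>\<^bsub>B\<^esub> p x"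
  shows "module K B" and "p \<in> linear_maps K A B"
proof -
  interpret A: module K A by fact
  have ex: "\<And>y. y \<in> carrier B \<Longrightarrow> \<exists>x \<in> carrier A. y = p x" using surj by auto
  have closed: "\<And>x. x \<in> carrier A \<Longrightarrow> p x \<in> carrier B" using surj by auto
  note simps = zero[symmetric] add[symmetric] smult[symmetric]
  show "module K B"
  proof (intro moduleI abelian_groupI)
    show "cring K" by (rule A.R.is_cring)
  next
    fix x assume "x \<in> carrier B"
    then obtain a where a: "a \<in> carrier A" "x = p a" using ex by blast
    show "\<exists>y\<in>carrier B. y \<oplus>\<^bsub>B\<^esub> x = \<zero>\<^bsub>B\<^esub>"
      by (rule bexI[of _ "p (\<ominus>\<^bsub>A\<^esub> a)"]) (use a closed in \<open>auto simp: simps A.M.l_neg\<close>)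
  qed (auto dest!: ex simp: simps closed A.smult_l_distr A.smult_r_distr A.smult_assoc1 A.M.a_ac)
  show "p \<in> linear_maps K A B"
    by (rule linear_mapsI) (auto simp: closed add smult)
qed


section \<open>Quotient modules\<close>

lemma quot_module_sel [simp]:
  "carrier (quot_module M N) = a_rcosets\<^bsub>M\<^esub> N"
  "zero (quot_module M N) = N"
  by (simp_all add: quot_module_def)

locale quotient = module K M + submodule N K M for K (structure) and M (structure) and N
begin

sublocale abelian_subgroup N M
  by (rule abelian_subgroupI3) (simp_all add: additive_subgroup_def subgroup_axioms abelian_group_axioms)

lemma coset_eq_iff:
  assumes "x \<in> carrier M" "y \<in> carrier M"
  shows "N +>\<^bsub>M\<^esub> x = N +>\<^bsub>M\<^esub> y \<longleftrightarrow> x \<ominus>\<^bsub>M\<^esub> y \<in> N"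
proof -
  have "N +>\<^bsub>M\<^esub> x = N +>\<^bsub>M\<^esub> y \<longleftrightarrow> x \<in> N +>\<^bsub>M\<^esub> y"
  proof
    assume "N +>\<^bsub>M\<^esub> x = N +>\<^bsub>M\<^esub> y"
    then show "x \<in> N +>\<^bsub>M\<^esub> y" using a_rcos_self[OF assms(1)] by simp
  next
    assume "x \<in> N +>\<^bsub>M\<^esub> y"
    then show "N +>\<^bsub>M\<^esub> x = N +>\<^bsub>M\<^esub> y"
      by (rule abelian_subgroup.a_repr_independence'[OF is_abelian_subgroup _ assms(2), symmetric])
  qed
  also have "\<dots> \<longleftrightarrow> x \<ominus>\<^bsub>M\<^esub> y \<in> N"
    unfolding a_minus_def by (rule a_rcos_module[OF assms(2,1)])
  finally show ?thesis .
qed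

lemma the_elem_coset:
  assumes "x \<in> carrier M"
    and "\<And>y. \<lbrakk>y \<in> carrier M; x \<ominus>\<^bsub>M\<^esub> y \<in> N\<rbrakk> \<Longrightarrow> f y = f x"
  shows "the_elem (f ` (N +>\<^bsub>M\<^esub> x)) = f x"
proof -
  have "f y = f x" if "y \<in> N +>\<^bsub>M\<^esub> x" for y
  proof -
    have y: "y \<in> carrier M" using that a_elemrcos_carrier assms(1) by blast
    moreover have "N +>\<^bsub>M\<^esub> x = N +>\<^bsub>M\<^esub> y" by (rule abelian_subgroup.a_repr_independence'[OF is_abelian_subgroup that assms(1)])
    ultimately show ?thesis using assms coset_eq_iff by blast
  qed
  moreover have "x \<in> N +>\<^bsub>M\<^esub> x" using assms(1) by (rule a_rcos_self)
  ultimately have "f ` (N +>\<^bsub>M\<^esub> x) = {f x}" by blast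
  then show ?thesis by simp
qed

lemma the_elem_coset_coset:
  assumes t: "t \<in> linear_maps K M M" and tN: "\<And>n. n \<in> N \<Longrightarrow> t n \<in> N" and x: "x \<in> carrier M"
  shows "the_elem ((\<lambda>x. N +>\<^bsub>M\<^esub> t x) ` (N +>\<^bsub>M\<^esub> x)) = N +>\<^bsub>M\<^esub> t x"
proof (rule the_elem_coset[OF x])
  interpret t: linear_map K M M t by (intro linear_mapI module_axioms t)
  fix y assume y: "y \<in> carrier M" "x \<ominus>\<^bsub>M\<^esub> y \<in> N"
  then have "t x \<ominus>\<^bsub>M\<^esub> t y \<in> N" using tN t.minus[OF x] by metis
  then show "N +>\<^bsub>M\<^esub> t y = N +>\<^bsub>M\<^esub> t x" using coset_eq_iff x y(1) t.closed by metis
qed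

lemma quot_module: "module K (quot_module M N)"
  and coset_linear: "(\<lambda>x. N +>\<^bsub>M\<^esub> x) \<in> linear_maps K M (quot_module M N)"
proof -
  have 1: "(\<lambda>x. N +>\<^bsub>M\<^esub> x) ` carrier M = carrier (quot_module M N)"
    unfolding quot_module_sel A_RCOSETS_def' by blast
  have 2: "N +>\<^bsub>M\<^esub> \<zero>\<^bsub>M\<^esub> = \<zero>\<^bsub>quot_module M N\<^esub>"
    using a_rcos_const[OF additive_subgroup.zero_closed[OF is_additive_subgroup]]
    by (simp only: quot_module_sel)
  have 3: "N +>\<^bsub>M\<^esub> (x \<oplus>\<^bsub>M\<^esub> y) = (N +>\<^bsub>M\<^esub> x) \<oplus>\<^bsub>quot_module M N\<^esub> (N +>\<^bsub>M\<^esub> y)"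
    if "x \<in> carrier M" "y \<in> carrier M" for x y
    using that by (simp add: quot_module_def a_rcos_sum)
  have 4: "N +>\<^bsub>M\<^esub> (a \<odot>\<^bsub>M\<^esub> x) = a \<odot>\<^bsub>quot_module M N\<^esub> (N +>\<^bsub>M\<^esub> x)"
    if "x \<in> carrier M" "a \<in> carrier K" for x a
    using that by (simp add: quot_module_def the_elem_coset_coset[OF smult_linear])
  show "module K (quot_module M N)"
    and "(\<lambda>x. N +>\<^bsub>M\<^esub> x) \<in> linear_maps K M (quot_module M N)"
    by (rule module_image[OF module_axioms 1 2]; use 3 4 in simp)+
qed

lemma coset_map: "linear_map K M (quot_module M N) (\<lambda>x. N +>\<^bsub>M\<^esub> x)"
  by (intro linear_mapI module_axioms quot_module coset_linear)

lemma coset_eq_zero_iff: "x \<in> carrier M \<Longrightarrow> N +>\<^bsub>M\<^esub> x = N \<longleftrightarrow> x \<in> N"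
  using a_rcos_const[of x] a_rcos_self[of x] by auto

lemma quot_cases:
  assumes "X \<in> carrier (quot_module M N)"
  obtains x where "x \<in> carrier M" "X = N +>\<^bsub>M\<^esub> x"
  using assms by (auto simp: A_RCOSETS_def')

text \<open>
  The factorisation of \<open>f\<close> through the quotient, as the common value of \<open>f\<close> on each coset.
\<close>
lemma
  assumes "linear_map K M B f" and fN: "\<And>n. n \<in> N \<Longrightarrow> f n = \<zero>\<^bsub>B\<^esub>"
  shows lift_coset: "x \<in> carrier M \<Longrightarrow> the_elem (f ` (N +>\<^bsub>M\<^esub> x)) = f x"
    and lift_linear: "linear_map K (quot_module M N) B (\<lambda>X. the_elem (f ` X))"
proof -
  interpret f: linear_map K M B f by fact
  interpret q: linear_map K M "quot_module M N" "\<lambda>x. N +>\<^bsub>M\<^esub> x" by (rule coset_map)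
  show val: "the_elem (f ` (N +>\<^bsub>M\<^esub> x)) = f x" if "x \<in> carrier M" for x
  proof (rule the_elem_coset[OF that])
    fix y assume y: "y \<in> carrier M" "x \<ominus>\<^bsub>M\<^esub> y \<in> N"
    then have "f x \<ominus>\<^bsub>B\<^esub> f y = \<zero>\<^bsub>B\<^esub>" using fN f.minus that by metis
    then show "f y = f x" using f.closed that y f.cod.minus_eq_zero_iff by metis
  qed
  show "linear_map K (quot_module M N) B (\<lambda>X. the_elem (f ` X))"
  proof (intro linear_mapI quot_module linear_mapsI)
    fix X Y assume "X \<in> carrier (quot_module M N)" "Y \<in> carrier (quot_module M N)"
    then show "the_elem (f ` (X \<oplus>\<^bsub>quot_module M N\<^esub> Y)) = the_elem (f ` X) \<oplus>\<^bsub>B\<^esub> the_elem (f ` Y)"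
      by (elim quot_cases) (simp add: q.add[symmetric] val del: q.hom_add)
  next
    fix a X assume "a \<in> carrier K" "X \<in> carrier (quot_module M N)"
    then show "the_elem (f ` (a \<odot>\<^bsub>quot_module M N\<^esub> X)) = a \<odot>\<^bsub>B\<^esub> the_elem (f ` X)"
      by (elim quot_cases) (simp add: q.smult[symmetric] val f.smult)
  next
    fix X assume "X \<in> carrier (quot_module M N)"
    then show "the_elem (f ` X) \<in> carrier B"
      by (elim quot_cases) (simp add: val)
  qed (rule f.cod.module_axioms)
qed

end

lemma quotientI: "\<lbrakk>module K M; submodule N K M\<rbrakk> \<Longrightarrow> quotient K M N"
  by (simp add: quotient_def)


section \<open>Free modules and tensor powers\<close>

lemma free_module_sel [simp]:
  "carrier (free_module K B) =
    {u. range u \<subseteq> carrier K \<and> finite {x. u x \<noteq> \<zero>\<^bsub>K\<^esub>} \<and> {x. u x \<noteq> \<zero>\<^bsub>K\<^esub>} \<subseteq> B}"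
  "zero (free_module K B) = (\<lambda>x. \<zero>\<^bsub>K\<^esub>)"
  "add (free_module K B) u v = (\<lambda>x. u x \<oplus>\<^bsub>K\<^esub> v x)"
  "smult (free_module K B) a u = (\<lambda>x. a \<otimes>\<^bsub>K\<^esub> u x)"
  by (simp_all add: free_module_def)

lemma free_moduleD:
  assumes "u \<in> carrier (free_module K B)"
  shows "u x \<in> carrier K" and "finite {x. u x \<noteq> \<zero>\<^bsub>K\<^esub>}" and "{x. u x \<noteq> \<zero>\<^bsub>K\<^esub>} \<subseteq> B"
  using assms by auto

context cring
begin

lemma free_module_closed:
  assumes "\<And>x. u x \<in> carrier R" "finite A" "A \<subseteq> B" "\<And>x. x \<notin> A \<Longrightarrow> u x = \<zero>"
  shows "u \<in> carrier (free_module R B)"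
proof -
  have "{x. u x \<noteq> \<zero>} \<subseteq> A" using assms(4) by auto
  then show ?thesis using assms finite_subset[of _ A] by auto
qed

lemma free_module: "module R (free_module R B)"
proof -
  have add: "(\<lambda>x. u x \<oplus> v x) \<in> carrier (free_module R B)"
    if "u \<in> carrier (free_module R B)" "v \<in> carrier (free_module R B)" for u v
    using free_moduleD[OF that(1)] free_moduleD[OF that(2)]
    by (intro free_module_closed[of _ "{x. u x \<noteq> \<zero>} \<union> {x. v x \<noteq> \<zero>}"]) auto
  have smult: "(\<lambda>x. a \<otimes> u x) \<in> carrier (free_module R B)"
    if "u \<in> carrier (free_module R B)" "a \<in> carrier R" for a u
    using free_moduleD[OF that(1)] that(2)
    by (intro free_module_closed[of _ "{x. u x \<noteq> \<zero>}"]) auto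
  show ?thesis
  proof (intro moduleI abelian_groupI, unfold free_module_sel(2-4))
    fix u assume u: "u \<in> carrier (free_module R B)"
    have "(\<lambda>x. \<ominus> u x) \<in> carrier (free_module R B)"
      using free_moduleD[OF u] by (intro free_module_closed[of _ "{x. u x \<noteq> \<zero>}"]) auto
    then show "\<exists>v \<in> carrier (free_module R B). (\<lambda>x. v x \<oplus> u x) = (\<lambda>x. \<zero>)"
      by (rule bexI[rotated]) (use free_moduleD(1)[OF u] in \<open>simp add: l_neg\<close>)
  next
    show "(\<lambda>x. \<zero>) \<in> carrier (free_module R B)" by auto
  qed (auto intro: add smult is_cring simp: a_ac m_assoc l_distr r_distr free_moduleD(1)
      simp del: free_module_sel)
qed

lemma basis_vec_closed: "x \<in> B \<Longrightarrow> basis_vec R x \<in> carrier (free_module R B)"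
  by (rule free_module_closed[of _ "{x}"]) (auto simp: basis_vec_def)

text \<open>
  Induction on a finite set containing the support of a vector: one coordinate at a time is
  split off as a multiple of a basis vector.
\<close>
lemma free_module_spanned:
  assumes N: "submodule N R (free_module R B)" and basis: "\<And>x. x \<in> B \<Longrightarrow> basis_vec R x \<in> N"
  shows "carrier (free_module R B) \<subseteq> N"
proof
  let ?F = "free_module R B"
  interpret F: module R ?F by (rule free_module)
  have "finite A \<Longrightarrow> A \<subseteq> B \<Longrightarrow> u \<in> carrier ?F \<Longrightarrow> {x. u x \<noteq> \<zero>} \<subseteq> A \<Longrightarrow> u \<in> N" for A u
  proof (induction A arbitrary: u rule: finite_induct)
    case empty
    then have "u = \<zero>\<^bsub>?F\<^esub>" by auto
    then show ?case using submodule.axioms(1)[OF N] subgroup.one_closed by fastforce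
  next
    case (insert b A)
    let ?v = "u(b := \<zero>)"
    have u: "\<And>x. u x \<in> carrier R" using insert.prems free_moduleD by metis
    have vF: "?v \<in> carrier ?F"
      by (rule free_module_closed[of _ A]) (use u insert in auto)
    then have v: "?v \<in> N" by (rule insert.IH[rotated]) (use insert.prems in auto)
    have "u b \<odot>\<^bsub>?F\<^esub> basis_vec R b \<in> N"
      by (rule F.submoduleE(4)[OF N u basis]) (use insert.prems in auto)
    with v have "?v \<oplus>\<^bsub>?F\<^esub> (u b \<odot>\<^bsub>?F\<^esub> basis_vec R b) \<in> N" by (rule F.submoduleE(5)[OF N])
    also have "?v \<oplus>\<^bsub>?F\<^esub> (u b \<odot>\<^bsub>?F\<^esub> basis_vec R b) = u"
      using u by (auto simp: basis_vec_def fun_eq_iff)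
    finally show ?case .
  qed
  then show "u \<in> N" if "u \<in> carrier ?F" for u
    using free_moduleD[OF that] that by blast
qed

end

context module
begin

text \<open>
  The sum may be taken over any finite set that contains the support; a common such set for two
  vectors gives additivity of the extension.
\<close>
lemma linear_extension_eq_finsum:
  assumes "finite A" "{x. u x \<noteq> \<zero>} \<subseteq> A" "f \<in> A \<rightarrow> carrier M" "\<And>x. u x \<in> carrier R"
  shows "linear_extension R M f u = (\<Oplus>\<^bsub>M\<^esub>x\<in>A. u x \<odot>\<^bsub>M\<^esub> f x)"
  unfolding linear_extension_def
proof (rule M.add.finprod_mono_neutral_cong_left)
  show "u x \<odot>\<^bsub>M\<^esub> f x = \<zero>\<^bsub>M\<^esub>" if "x \<in> A - {x. u x \<noteq> \<zero>}" for x
    using assms(3) that by (auto simp: Pi_iff)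
qed (use assms in \<open>auto simp: Pi_iff\<close>)

lemma linear_extension_basis_vec:
  "f x \<in> carrier M \<Longrightarrow> linear_extension R M f (basis_vec R x) = f x"
  by (subst linear_extension_eq_finsum[of "{x}"]) (auto simp: basis_vec_def)

lemma linear_extension_linear:
  assumes f: "f \<in> B \<rightarrow> carrier M"
  shows "linear_map R (free_module R B) M (linear_extension R M f)"
proof -
  have supp: "linear_extension R M f u = (\<Oplus>\<^bsub>M\<^esub>x\<in>A. u x \<odot>\<^bsub>M\<^esub> f x)"
    if "u \<in> carrier (free_module R B)" "finite A" "{x. u x \<noteq> \<zero>} \<subseteq> A" "A \<subseteq> B" for u A
    using that f free_moduleD(1)[OF that(1)] by (intro linear_extension_eq_finsum) auto
  interpret F: module R "free_module R B" by (rule R.free_module)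
  show ?thesis
  proof (intro linear_mapI linear_mapsI F.module_axioms module_axioms)
    fix u assume u: "u \<in> carrier (free_module R B)"
    note uD = free_moduleD[OF u]
    show "linear_extension R M f u \<in> carrier M"
      unfolding linear_extension_def using uD f by (intro M.finsum_closed) auto
    {
      fix v assume v: "v \<in> carrier (free_module R B)"
      note vD = free_moduleD[OF v]
      let ?A = "{x. u x \<noteq> \<zero>} \<union> {x. v x \<noteq> \<zero>}"
      have A: "finite ?A" "?A \<subseteq> B" using uD vD by auto
      have fA: "x \<in> ?A \<Longrightarrow> f x \<in> carrier M" for x using A(2) f by auto
      let ?w = "u \<oplus>\<^bsub>free_module R B\<^esub> v"
      have w: "?w \<in> carrier (free_module R B)" using u v by (rule F.add.m_closed)
      have wA: "{x. ?w x \<noteq> \<zero>} \<subseteq> ?A" by auto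
      have "linear_extension R M f ?w = (\<Oplus>\<^bsub>M\<^esub>x\<in>?A. ?w x \<odot>\<^bsub>M\<^esub> f x)"
        by (rule supp[OF w A(1) wA A(2)])
      also have "\<dots> = (\<Oplus>\<^bsub>M\<^esub>x\<in>?A. u x \<odot>\<^bsub>M\<^esub> f x \<oplus>\<^bsub>M\<^esub> v x \<odot>\<^bsub>M\<^esub> f x)"
        by (rule M.add.finprod_cong') (use uD(1) vD(1) fA in \<open>auto simp: smult_l_distr\<close>)
      also have "\<dots> = (\<Oplus>\<^bsub>M\<^esub>x\<in>?A. u x \<odot>\<^bsub>M\<^esub> f x) \<oplus>\<^bsub>M\<^esub> (\<Oplus>\<^bsub>M\<^esub>x\<in>?A. v x \<odot>\<^bsub>M\<^esub> f x)"
        by (rule M.finsum_addf) (use uD(1) vD(1) fA in auto)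
      also have "\<dots> = linear_extension R M f u \<oplus>\<^bsub>M\<^esub> linear_extension R M f v"
        by (simp only: supp[OF u A(1) _ A(2)] supp[OF v A(1) _ A(2)] Un_upper1 Un_upper2)
      finally show "linear_extension R M f ?w = linear_extension R M f u \<oplus>\<^bsub>M\<^esub> linear_extension R M f v" .
    }
    {
      fix a assume a: "a \<in> carrier R"
      let ?A = "{x. u x \<noteq> \<zero>}"
      have fA: "x \<in> ?A \<Longrightarrow> f x \<in> carrier M" for x using uD(3) f by auto
      let ?w = "a \<odot>\<^bsub>free_module R B\<^esub> u"
      have w: "?w \<in> carrier (free_module R B)" using a u by (rule F.smult_closed)
      have wA: "{x. ?w x \<noteq> \<zero>} \<subseteq> ?A" using a by auto
      have "linear_extension R M f ?w = (\<Oplus>\<^bsub>M\<^esub>x\<in>?A. ?w x \<odot>\<^bsub>M\<^esub> f x)"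
        by (rule supp[OF w uD(2) wA uD(3)])
      also have "\<dots> = (\<Oplus>\<^bsub>M\<^esub>x\<in>?A. a \<odot>\<^bsub>M\<^esub> (u x \<odot>\<^bsub>M\<^esub> f x))"
        by (rule M.add.finprod_cong') (use uD(1) fA a in \<open>auto simp: smult_assoc1\<close>)
      also have "\<dots> = a \<odot>\<^bsub>M\<^esub> (\<Oplus>\<^bsub>M\<^esub>x\<in>?A. u x \<odot>\<^bsub>M\<^esub> f x)"
        by (rule finsum_smult_ldistr[symmetric]) (use uD(1,2) fA a in auto)
      finally show "linear_extension R M f ?w = a \<odot>\<^bsub>M\<^esub> linear_extension R M f u"
        by (simp add: linear_extension_def)
    }
  qed
qed

end

definition multilinear ::
    "('k, 'm) ring_scheme \<Rightarrow> ('k, 'a, 'x) module_scheme \<Rightarrow> nat \<Rightarrow> ('k, 'b, 'y) module_scheme \<Rightarrow>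
      ('a list \<Rightarrow> 'b) \<Rightarrow> bool"
  where "multilinear K M n N f \<longleftrightarrow>
    f \<in> tuples M n \<rightarrow> carrier N \<and>
    (\<forall>xs \<in> tuples M n. \<forall>i < n. (\<lambda>x. f (xs[i := x])) \<in> linear_maps K M N)"

lemma tuples_update: "\<lbrakk>xs \<in> tuples M n; x \<in> carrier M\<rbrakk> \<Longrightarrow> xs[i := x] \<in> tuples M n"
  using set_update_subset_insert[of xs i x] by (auto simp: tuples_def)

locale tensor = module K M for K (structure) and M (structure) + fixes n :: nat
begin

abbreviation T where "T \<equiv> free_module K (tuples M n)"

lemma multilinear_rels_closed: "multilinear_rels K M n \<subseteq> carrier T"
proof -
  interpret T: module K T by (rule R.free_module)
  have "basis_vec K (xs[i := x]) \<in> carrier T" if "xs \<in> tuples M n" "x \<in> carrier M" for xs i x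
    by (intro R.basis_vec_closed tuples_update that)
  then show ?thesis
    unfolding multilinear_rels_def Let_def by (auto simp del: free_module_sel intro!: T.minus_closed)
qed

sublocale T: quotient K T "tensor_null K M n"
  unfolding tensor_null_def
  by (intro quotientI R.free_module module.linear_span_submodule multilinear_rels_closed)

lemma tensor_power: "module K (tensor_power K M n)"
  unfolding tensor_power_def by (rule T.quot_module)

lemma pure_tensor_eq:
  "xs \<in> tuples M n \<Longrightarrow> pure_tensor K M xs = tensor_null K M n +>\<^bsub>T\<^esub> basis_vec K xs"
  by (simp add: pure_tensor_def tuples_def)

lemma pure_tensor_multilinear: "multilinear K M n (tensor_power K M n) (pure_tensor K M)"
proof -
  let ?q = "\<lambda>u. tensor_null K M n +>\<^bsub>T\<^esub> u"
  interpret q: linear_map K T "tensor_power K M n" ?q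
    unfolding tensor_power_def by (rule T.coset_map)
  note e = R.basis_vec_closed[of _ "tuples M n"]
  have rel: "multilinear_rels K M n \<subseteq> tensor_null K M n"
    unfolding tensor_null_def by (rule module.linear_span_superset[OF R.free_module])
  have closed: "pure_tensor K M xs \<in> carrier (tensor_power K M n)" if "xs \<in> tuples M n" for xs
    using that by (simp only: pure_tensor_eq q.closed e)
  have 1: "?q (basis_vec K (xs[i := x \<oplus>\<^bsub>M\<^esub> y]))
      = ?q (basis_vec K (xs[i := x]) \<oplus>\<^bsub>T\<^esub> basis_vec K (xs[i := y]))"
    if that': "xs \<in> tuples M n" "i < n" "x \<in> carrier M" "y \<in> carrier M" for xs i x y
  proof (rule T.coset_eq_iff[THEN iffD2])
    show "basis_vec K (xs[i := x \<oplus>\<^bsub>M\<^esub> y]) \<ominus>\<^bsub>T\<^esub>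
        (basis_vec K (xs[i := x]) \<oplus>\<^bsub>T\<^esub> basis_vec K (xs[i := y])) \<in> tensor_null K M n"
      by (rule subsetD[OF rel]) (unfold multilinear_rels_def Let_def, use that' in blast)
  qed (intro T.M.a_closed e tuples_update that' M.a_closed)+
  have 2: "?q (basis_vec K (xs[i := a \<odot>\<^bsub>M\<^esub> x])) = ?q (a \<odot>\<^bsub>T\<^esub> basis_vec K (xs[i := x]))"
    if that': "xs \<in> tuples M n" "i < n" "a \<in> carrier K" "x \<in> carrier M" for xs i a x
  proof (rule T.coset_eq_iff[THEN iffD2])
    show "basis_vec K (xs[i := a \<odot>\<^bsub>M\<^esub> x]) \<ominus>\<^bsub>T\<^esub>
        (a \<odot>\<^bsub>T\<^esub> basis_vec K (xs[i := x])) \<in> tensor_null K M n"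
      by (rule subsetD[OF rel]) (unfold multilinear_rels_def Let_def, use that' in blast)
  qed (intro module.smult_closed[OF T.module_axioms] e tuples_update that' smult_closed)+
  show ?thesis
    unfolding multilinear_def
  proof (intro conjI ballI allI impI linear_mapsI)
    show "pure_tensor K M \<in> tuples M n \<rightarrow> carrier (tensor_power K M n)" using closed by blast
  qed (simp_all only: pure_tensor_eq 1 2 q.closed q.add q.smult e tuples_update
      smult_closed M.a_closed)
qed

lemma pure_tensor_closed: "xs \<in> tuples M n \<Longrightarrow> pure_tensor K M xs \<in> carrier (tensor_power K M n)"
  using pure_tensor_multilinear by (auto simp: multilinear_def)

text \<open>
  The universal property of the tensor power: multilinearity of \<open>f\<close> says that the linear extension
  of \<open>f\<close> kills the relations, hence their span.
\<close>
lemma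
  assumes "module K N" and f: "multilinear K M n N f"
  shows tensor_lift: "linear_map K (tensor_power K M n) N (tensor_lift K N f)"
    and tensor_lift_pure: "xs \<in> tuples M n \<Longrightarrow> tensor_lift K N f (pure_tensor K M xs) = f xs"
proof -
  interpret N: module K N by fact
  have f_closed: "f \<in> tuples M n \<rightarrow> carrier N" using f by (simp add: multilinear_def)
  interpret e: linear_map K T N "linear_extension K N f"
    by (rule N.linear_extension_linear[OF f_closed])
  note b = R.basis_vec_closed[of _ "tuples M n"]
  have eb: "linear_extension K N f (basis_vec K xs) = f xs" if "xs \<in> tuples M n" for xs
    using f_closed that by (intro N.linear_extension_basis_vec) auto
  have "multilinear_rels K M n \<subseteq> {u \<in> carrier T. linear_extension K N f u \<in> {\<zero>\<^bsub>N\<^esub>}}"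
  proof
    fix r assume r: "r \<in> multilinear_rels K M n"
    then have "r \<in> carrier T" using multilinear_rels_closed by blast
    moreover have "linear_extension K N f r = \<zero>\<^bsub>N\<^esub>"
    proof -
      consider (add) xs i x y where "xs \<in> tuples M n" "i < n" "x \<in> carrier M" "y \<in> carrier M"
          "r = basis_vec K (xs[i := x \<oplus>\<^bsub>M\<^esub> y]) \<ominus>\<^bsub>T\<^esub>
            (basis_vec K (xs[i := x]) \<oplus>\<^bsub>T\<^esub> basis_vec K (xs[i := y]))"
        | (smult) xs i a x where "xs \<in> tuples M n" "i < n" "a \<in> carrier K" "x \<in> carrier M"
          "r = basis_vec K (xs[i := a \<odot>\<^bsub>M\<^esub> x]) \<ominus>\<^bsub>T\<^esub> (a \<odot>\<^bsub>T\<^esub> basis_vec K (xs[i := x]))"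
        using r unfolding multilinear_rels_def Let_def by blast
      then show ?thesis
      proof cases
        case add
        have "linear_extension K N f r =
            f (xs[i := x \<oplus>\<^bsub>M\<^esub> y]) \<ominus>\<^bsub>N\<^esub> (f (xs[i := x]) \<oplus>\<^bsub>N\<^esub> f (xs[i := y]))"
          using add by (simp only: e.minus e.add b eb tuples_update T.M.a_closed M.a_closed)
        also have "f (xs[i := x \<oplus>\<^bsub>M\<^esub> y]) = f (xs[i := x]) \<oplus>\<^bsub>N\<^esub> f (xs[i := y])"
          using f add linear_mapsD(2) unfolding multilinear_def by fastforce
        finally show ?thesis
          using f_closed add tuples_update N.minus_eq_zero_iff by (metis N.add.m_closed PiE)
      next
        case smult
        have "linear_extension K N f r = f (xs[i := a \<odot>\<^bsub>M\<^esub> x]) \<ominus>\<^bsub>N\<^esub> (a \<odot>\<^bsub>N\<^esub> f (xs[i := x]))"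
          using smult by (simp only: e.minus e.smult b eb tuples_update module.smult_closed[OF T.module_axioms]
              smult_closed)
        also have "f (xs[i := a \<odot>\<^bsub>M\<^esub> x]) = a \<odot>\<^bsub>N\<^esub> f (xs[i := x])"
          using f smult linear_mapsD(3) unfolding multilinear_def by fastforce
        finally show ?thesis
          using f_closed smult tuples_update N.minus_eq_zero_iff by (metis N.smult_closed PiE)
      qed
    qed
    ultimately show "r \<in> {u \<in> carrier T. linear_extension K N f u \<in> {\<zero>\<^bsub>N\<^esub>}}" by blast
  qed
  then have "tensor_null K M n \<subseteq> {u \<in> carrier T. linear_extension K N f u \<in> {\<zero>\<^bsub>N\<^esub>}}"
    unfolding tensor_null_def
    by (intro T.linear_span_minimal e.submodule_vimage N.submodule_zero)
  then have null: "\<And>u. u \<in> tensor_null K M n \<Longrightarrow> linear_extension K N f u = \<zero>\<^bsub>N\<^esub>" by blast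
  have lift_eq: "tensor_lift K N f = (\<lambda>X. the_elem (linear_extension K N f ` X))"
    by (rule ext) (simp add: tensor_lift_def)
  show "linear_map K (tensor_power K M n) N (tensor_lift K N f)"
    unfolding tensor_power_def lift_eq by (rule T.lift_linear[OF e.linear_map_axioms null])
  show "tensor_lift K N f (pure_tensor K M xs) = f xs" if "xs \<in> tuples M n"
    using that T.lift_coset[OF e.linear_map_axioms null b[OF that]]
    by (simp only: pure_tensor_eq eb tensor_lift_def)
qed

lemma tensor_power_spanned:
  assumes N: "submodule N K (tensor_power K M n)"
    and pure: "\<And>xs. xs \<in> tuples M n \<Longrightarrow> pure_tensor K M xs \<in> N"
  shows "carrier (tensor_power K M n) \<subseteq> N"
proof -
  let ?q = "\<lambda>u. tensor_null K M n +>\<^bsub>T\<^esub> u"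
  interpret q: linear_map K T "tensor_power K M n" ?q
    unfolding tensor_power_def by (rule T.coset_map)
  have "carrier T \<subseteq> {u \<in> carrier T. ?q u \<in> N}"
  proof (rule R.free_module_spanned[OF q.submodule_vimage[OF N]])
    fix xs assume xs: "xs \<in> tuples M n"
    show "basis_vec K xs \<in> {u \<in> carrier T. ?q u \<in> N}"
      using pure[OF xs] R.basis_vec_closed[OF xs] pure_tensor_eq[OF xs] by (simp only: mem_Collect_eq simp_thms)
  qed
  then show ?thesis
    unfolding tensor_power_def by (blast elim: T.quot_cases)
qed

lemma tensor_power_maps_eq:
  assumes "linear_map K (tensor_power K M n) N f" "linear_map K (tensor_power K M n) N g"
    and "\<And>xs. xs \<in> tuples M n \<Longrightarrow> f (pure_tensor K M xs) = g (pure_tensor K M xs)"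
    and "t \<in> carrier (tensor_power K M n)"
  shows "f t = g t"
  using tensor_power_spanned[OF submodule_equalizer[OF assms(1,2)]] assms(3,4) pure_tensor_closed
  by blast

end


section \<open>Hom-vector spaces\<close>

lemma hom_space_homsD:
  assumes "f \<in> hom_space_homs K A B"
  shows "f \<in> linear_maps K A B" and "x \<in> carrier A \<Longrightarrow> f (twist A x) = twist B (f x)"
  using assms by (auto simp: hom_space_homs_def)

lemma hom_leibniz_homsD:
  assumes "f \<in> hom_leibniz_homs K A B"
  shows "f \<in> hom_space_homs K A B"
    and "\<lbrakk>x \<in> carrier A; y \<in> carrier A\<rbrakk> \<Longrightarrow> f (bracket A x y) = bracket B (f x) (f y)"
  using assms by (auto simp: hom_leibniz_homs_def)

lemma hom_space_homs_comp:
  "\<lbrakk>f \<in> hom_space_homs K A B; g \<in> hom_space_homs K B C\<rbrakk> \<Longrightarrow> (\<lambda>x. g (f x)) \<in> hom_space_homs K A C"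
  by (auto simp: hom_space_homs_def linear_maps_comp linear_mapsD)

lemma hom_leibniz_homs_comp:
  "\<lbrakk>f \<in> hom_leibniz_homs K A B; g \<in> hom_leibniz_homs K B C\<rbrakk> \<Longrightarrow>
    (\<lambda>x. g (f x)) \<in> hom_leibniz_homs K A C"
  by (auto simp: hom_leibniz_homs_def hom_space_homs_comp)
    (auto simp: hom_space_homs_def linear_mapsD)

lemma (in hom_vector_space) twist_closed: "x \<in> carrier V \<Longrightarrow> twist V x \<in> carrier V"
  by (rule linear_mapsD(1)[OF twist_linear])

lemma linear_map_hom_spaces:
  "\<lbrakk>hom_vector_space K A; hom_vector_space K B; f \<in> hom_space_homs K A B\<rbrakk> \<Longrightarrow> linear_map K A B f"
  by (intro linear_mapI) (auto simp: hom_vector_space_def hom_space_homs_def)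

lemma hom_vector_space_image:
  assumes "hom_vector_space K A" and surj: "p ` carrier A = carrier B"
    and zero: "p \<zero>\<^bsub>A\<^esub> = \<zero>\<^bsub>B\<^esub>" and lin: "p \<in> linear_maps K A B"
    and twist: "\<And>x. x \<in> carrier A \<Longrightarrow> p (twist A x) = twist B (p x)"
  shows "hom_vector_space K B" and "p \<in> hom_space_homs K A B"
proof -
  interpret A: hom_vector_space K A by fact
  note add = linear_mapsD(2)[OF lin] and smult = linear_mapsD(3)[OF lin]
  interpret B: module K B
    by (rule module_image[OF A.module_axioms surj zero]) (auto simp: add smult)
  have t: "twist B \<in> linear_maps K B B"
  proof (rule linear_mapsI)
    fix y assume "y \<in> carrier B"
    then obtain x where x: "x \<in> carrier A" "y = p x" using surj by auto
    then show "twist B y \<in> carrier B"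
      by (simp add: twist[symmetric] linear_mapsD(1)[OF lin] A.twist_closed)
    {
      fix z assume "z \<in> carrier B"
      then obtain w where w: "w \<in> carrier A" "z = p w" using surj by auto
      show "twist B (y \<oplus>\<^bsub>B\<^esub> z) = twist B y \<oplus>\<^bsub>B\<^esub> twist B z"
        using x w by (simp add: twist[symmetric] add[symmetric] A.twist_closed
            linear_mapsD(2)[OF A.twist_linear])
    }
    {
      fix a assume "a \<in> carrier K"
      then show "twist B (a \<odot>\<^bsub>B\<^esub> y) = a \<odot>\<^bsub>B\<^esub> twist B y"
        using x by (simp add: twist[symmetric] smult[symmetric] A.twist_closed
            linear_mapsD(3)[OF A.twist_linear])
    }
  qed
  show "hom_vector_space K B"
    by (intro hom_vector_space.intro hom_vector_space_axioms.intro A.field_axioms B.module_axioms t)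
  show "p \<in> hom_space_homs K A B"
    by (simp add: hom_space_homs_def lin twist)
qed

lemma hom_leibniz_algebra_image:
  assumes "hom_leibniz_algebra K A" and surj: "p ` carrier A = carrier B"
    and zero: "p \<zero>\<^bsub>A\<^esub> = \<zero>\<^bsub>B\<^esub>" and lin: "p \<in> linear_maps K A B"
    and twist: "\<And>x. x \<in> carrier A \<Longrightarrow> p (twist A x) = twist B (p x)"
    and bracket: "\<And>x y. \<lbrakk>x \<in> carrier A; y \<in> carrier A\<rbrakk> \<Longrightarrow> p (bracket A x y) = bracket B (p x) (p y)"
  shows "hom_leibniz_algebra K B" and "p \<in> hom_leibniz_homs K A B"
proof -
  interpret A: hom_leibniz_algebra K A by fact
  interpret B: hom_vector_space K B
    by (rule hom_vector_space_image[OF A.hom_vector_space_axioms surj zero lin twist])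
  show p: "p \<in> hom_leibniz_homs K A B"
    by (simp add: hom_leibniz_homs_def hom_space_homs_def lin twist bracket)
  interpret p: linear_map K A B p
    by (intro linear_mapI A.module_axioms B.module_axioms lin)
  have ex: "\<And>y. y \<in> carrier B \<Longrightarrow> \<exists>x \<in> carrier A. y = p x" using surj by auto
  note cl = linear_mapsD(1)[OF A.bracket_linear_right] A.twist_closed
  note simps = bracket[symmetric] twist[symmetric] p.add[symmetric] p.smult[symmetric]
    p.minus[symmetric] cl p.closed
  show "hom_leibniz_algebra K B"
  proof (intro hom_leibniz_algebra.intro hom_leibniz_algebra_axioms.intro B.hom_vector_space_axioms
      linear_mapsI)
    fix x y z assume "x \<in> carrier B" "y \<in> carrier B" "z \<in> carrier B"
    then obtain a b c where a: "a \<in> carrier A" "b \<in> carrier A" "c \<in> carrier A"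
      "x = p a" "y = p b" "z = p c" using ex[of x] ex[of y] ex[of z] by blast
    show "bracket B (twist B x) (bracket B y z) =
        bracket B (bracket B x y) (twist B z) \<ominus>\<^bsub>B\<^esub> bracket B (bracket B x z) (twist B y)"
    proof -
      have "bracket B (twist B x) (bracket B y z) = p (bracket A (twist A a) (bracket A b c))"
        using a by (simp add: bracket twist cl)
      also have "\<dots> = bracket B (bracket B x y) (twist B z) \<ominus>\<^bsub>B\<^esub> bracket B (bracket B x z) (twist B y)"
        using a by (simp add: A.hom_leibniz_identity p.minus bracket twist cl)
      finally show ?thesis .
    qed
  next
    fix y x assume "y \<in> carrier B" "x \<in> carrier B"
    then obtain a b where a: "a \<in> carrier A" "b \<in> carrier A" "x = p a" "y = p b" using ex[of x] ex[of y] by blast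
    then show "bracket B x y \<in> carrier B" "bracket B y x \<in> carrier B"
      by (simp_all add: simps)
    show "twist B (bracket B x y) = bracket B (twist B x) (twist B y)"
      using a by (simp add: simps A.twist_bracket)
    fix z assume "z \<in> carrier B"
    then obtain c where c: "c \<in> carrier A" "z = p c" using ex[of z] by blast
    show "bracket B (x \<oplus>\<^bsub>B\<^esub> z) y = bracket B x y \<oplus>\<^bsub>B\<^esub> bracket B z y"
      using a c linear_mapsD(2)[OF A.bracket_linear_left]
      by (simp add: simps del: p.hom_add)
    show "bracket B x (y \<oplus>\<^bsub>B\<^esub> z) = bracket B x y \<oplus>\<^bsub>B\<^esub> bracket B x z"
      using a c linear_mapsD(2)[OF A.bracket_linear_right]
      by (simp add: simps del: p.hom_add)
  next
    fix y x k assume "y \<in> carrier B" "x \<in> carrier B" and k: "k \<in> carrier K"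
    then obtain a b where a: "a \<in> carrier A" "b \<in> carrier A" "x = p a" "y = p b" using ex[of x] ex[of y] by blast
    show "bracket B (k \<odot>\<^bsub>B\<^esub> x) y = k \<odot>\<^bsub>B\<^esub> bracket B x y"
      using a k linear_mapsD(3)[OF A.bracket_linear_left] by (simp add: simps)
    show "bracket B x (k \<odot>\<^bsub>B\<^esub> y) = k \<odot>\<^bsub>B\<^esub> bracket B x y"
      using a k linear_mapsD(3)[OF A.bracket_linear_right] by (simp add: simps)
  qed
qed

lemma linear_map_restrict:
  assumes "linear_map K A B f" "submodule S K A" "submodule S' K B" "f ` S \<subseteq> S'"
  shows "linear_map K (A\<lparr>carrier := S\<rparr>) (B\<lparr>carrier := S'\<rparr>) f"
proof -
  interpret f: linear_map K A B f by fact
  have "S \<subseteq> carrier A" by (rule f.dom.submoduleE[OF assms(2)])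
  then show ?thesis
    using assms(4) f.smult by (intro linear_mapI submodule.submodule_is_module[OF assms(2) f.dom.module_axioms]
        submodule.submodule_is_module[OF assms(3) f.cod.module_axioms] linear_mapsI)
      (auto simp: subsetD)
qed

lemma (in hom_vector_space) restrict:
  assumes "submodule S K V" "\<And>x. x \<in> S \<Longrightarrow> twist V x \<in> S"
  shows "hom_vector_space K (V\<lparr>carrier := S\<rparr>)"
proof -
  interpret t: linear_map K V V "twist V" by (intro linear_mapI module_axioms twist_linear)
  interpret t': linear_map K "V\<lparr>carrier := S\<rparr>" "V\<lparr>carrier := S\<rparr>" "twist V"
    by (rule linear_map_restrict[OF t.linear_map_axioms]) (use assms in auto)
  show ?thesis
    using t'.linear
    by (intro hom_vector_space.intro hom_vector_space_axioms.intro field_axioms t'.dom.module_axioms) simp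
qed

lemma (in hom_vector_space)
  assumes S: "submodule S K V" "\<And>x. x \<in> S \<Longrightarrow> twist V x \<in> S"
    and N: "hom_vector_space K N" and h: "h \<in> hom_space_homs K V N"
  shows image_hom_vector_space: "hom_vector_space K (N\<lparr>carrier := h ` S\<rparr>)"
    and restrict_hom: "h \<in> hom_space_homs K (V\<lparr>carrier := S\<rparr>) (N\<lparr>carrier := h ` S\<rparr>)"
proof -
  interpret h: linear_map K V N h by (rule linear_map_hom_spaces[OF hom_vector_space_axioms N h])
  interpret h': linear_map K "V\<lparr>carrier := S\<rparr>" "N\<lparr>carrier := h ` S\<rparr>" h
    by (rule linear_map_restrict[OF h.linear_map_axioms S(1) h.submodule_image[OF S(1)]]) simp
  have "S \<subseteq> carrier V" by (rule submoduleE[OF S(1)])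
  then have twist: "h (twist (V\<lparr>carrier := S\<rparr>) x) = twist (N\<lparr>carrier := h ` S\<rparr>) (h x)"
    if "x \<in> carrier (V\<lparr>carrier := S\<rparr>)" for x
    using that hom_space_homsD(2)[OF h] by auto
  have "h ` carrier (V\<lparr>carrier := S\<rparr>) = carrier (N\<lparr>carrier := h ` S\<rparr>)" by simp
  note img = hom_vector_space_image[OF restrict[OF S] this h'.hom_zero h'.linear twist]
  show "hom_vector_space K (N\<lparr>carrier := h ` S\<rparr>)" by (rule img(1))
  show "h \<in> hom_space_homs K (V\<lparr>carrier := S\<rparr>) (N\<lparr>carrier := h ` S\<rparr>)" by (rule img(2))
qed

lemma with_twist_sel [simp]:
  "carrier (with_twist M t) = carrier M" "zero (with_twist M t) = zero M"
  "add (with_twist M t) = add M" "smult (with_twist M t) = smult M" "twist (with_twist M t) = t"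
  by (simp_all add: with_twist_def module.defs hom_module.defs)

lemma linear_maps_with_twist [simp]:
  "linear_maps K (with_twist A t) B = linear_maps K A B"
  "linear_maps K A' (with_twist B' t') = linear_maps K A' B'"
  by (simp_all add: linear_maps_def)

lemma module_with_twist: "module K A \<Longrightarrow> module K (with_twist A t)"
  by (rule module_image(1)[of K A "\<lambda>x. x"]) auto

lemma (in field) hom_vector_space_with_twist:
  assumes "module R A" "t \<in> linear_maps R A A"
  shows "hom_vector_space R (with_twist A t)"
  by (intro hom_vector_space.intro hom_vector_space_axioms.intro field_axioms module_with_twist)
    (use assms in auto)

lemma linear_map_with_twist:
  "linear_map K A B f \<Longrightarrow> linear_map K (with_twist A t) (with_twist B t') f"
  unfolding linear_map_def linear_map_axioms_def by (auto intro: module_with_twist)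

lemma quot_hom_space_sel [simp]: "carrier (quot_hom_space V N) = a_rcosets\<^bsub>V\<^esub> N"
  "\<zero>\<^bsub>quot_hom_space V N\<^esub> = N"
  by (simp_all add: quot_hom_space_def)

text \<open>
  The operations on cosets mention the carrier of \<open>V\<close> nowhere.  So a quotient of a subspace
  consists of cosets in the quotient of the whole space; this applies both to homology, a quotient
  of the cycles, and to the Schur multiplier, a quotient of \<open>I \<inter> [F, F]\<close>.
\<close>
lemma quot_hom_space_restrict:
  "quot_hom_space (V\<lparr>carrier := S\<rparr>) N =
    (quot_hom_space V N)\<lparr>carrier := (\<lambda>x. N +>\<^bsub>V\<^esub> x) ` S\<rparr>"
  by (auto simp: quot_hom_space_def quot_module_def with_twist_def module.defs hom_module.defs
      A_RCOSETS_def' a_r_coset_def' set_add_def' fun_eq_iff)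

lemma (in hom_vector_space)
  assumes N: "submodule N K V" and tN: "\<And>x. x \<in> N \<Longrightarrow> twist V x \<in> N"
  shows quot_hom_space: "hom_vector_space K (quot_hom_space V N)"
    and coset_hom: "(\<lambda>x. N +>\<^bsub>V\<^esub> x) \<in> hom_space_homs K V (quot_hom_space V N)"
proof -
  interpret q: quotient K V N by (intro quotientI module_axioms N)
  have surj: "(\<lambda>x. N +>\<^bsub>V\<^esub> x) ` carrier V = carrier (quot_hom_space V N)"
    unfolding quot_hom_space_sel A_RCOSETS_def' by blast
  have zero: "N +>\<^bsub>V\<^esub> \<zero>\<^bsub>V\<^esub> = \<zero>\<^bsub>quot_hom_space V N\<^esub>"
    using q.coset_eq_zero_iff[of "\<zero>\<^bsub>V\<^esub>"] submodule.axioms(1)[OF N] subgroup.one_closed[of N]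
    by fastforce
  have lin: "(\<lambda>x. N +>\<^bsub>V\<^esub> x) \<in> linear_maps K V (quot_hom_space V N)"
    using q.coset_linear by (simp add: quot_hom_space_def)
  have twist: "N +>\<^bsub>V\<^esub> twist V x = twist (quot_hom_space V N) (N +>\<^bsub>V\<^esub> x)" if "x \<in> carrier V" for x
    using q.the_elem_coset_coset[OF twist_linear tN that] by (simp add: quot_hom_space_def)
  show "hom_vector_space K (quot_hom_space V N)"
    by (rule hom_vector_space_image(1)[OF hom_vector_space_axioms surj zero lin twist])
  show "(\<lambda>x. N +>\<^bsub>V\<^esub> x) \<in> hom_space_homs K V (quot_hom_space V N)"
    by (rule hom_vector_space_image(2)[OF hom_vector_space_axioms surj zero lin twist])
qed

text \<open>
  Two surjections with the same kernel have isomorphic targets: the isomorphism sends \<open>p x\<close> to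
  \<open>q x\<close>.
\<close>
lemma hom_space_iso_of_common_cover:
  assumes A: "hom_vector_space K A" and B: "hom_vector_space K B" and C: "hom_vector_space K C"
    and p: "p \<in> hom_space_homs K A B" "p ` carrier A = carrier B"
    and q: "q \<in> hom_space_homs K A C" "q ` carrier A = carrier C"
    and ker: "\<And>x. x \<in> carrier A \<Longrightarrow> p x = \<zero>\<^bsub>B\<^esub> \<longleftrightarrow> q x = \<zero>\<^bsub>C\<^esub>"
  shows "hom_space_iso K B C"
proof -
  interpret A: hom_vector_space K A by fact
  interpret B: hom_vector_space K B by fact
  interpret C: hom_vector_space K C by fact
  interpret p: linear_map K A B p by (rule linear_map_hom_spaces[OF A B p(1)])
  interpret q: linear_map K A C q by (rule linear_map_hom_spaces[OF A C q(1)])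
  have eq: "p x = p y \<longleftrightarrow> q x = q y" if "x \<in> carrier A" "y \<in> carrier A" for x y
  proof -
    have "p x = p y \<longleftrightarrow> p (x \<ominus>\<^bsub>A\<^esub> y) = \<zero>\<^bsub>B\<^esub>"
      using that by (simp add: p.minus B.minus_eq_zero_iff)
    also have "\<dots> \<longleftrightarrow> q (x \<ominus>\<^bsub>A\<^esub> y) = \<zero>\<^bsub>C\<^esub>" using that by (simp add: ker)
    also have "\<dots> \<longleftrightarrow> q x = q y" using that by (simp add: q.minus C.minus_eq_zero_iff)
    finally show ?thesis .
  qed
  define s where "s = inv_into (carrier A) p"
  have s: "s y \<in> carrier A" "p (s y) = y" if "y \<in> carrier B" for y
    using that p(2) by (auto simp: s_def inv_into_into f_inv_into_f)
  have val: "q (s (p x)) = q x" if "x \<in> carrier A" for x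
    using that s[of "p x"] eq by simp
  have ex: "\<And>y. y \<in> carrier B \<Longrightarrow> \<exists>x \<in> carrier A. y = p x" using p(2) by auto
  have "(\<lambda>y. q (s y)) \<in> hom_space_homs K B C"
    unfolding hom_space_homs_def
  proof (intro CollectI conjI ballI linear_mapsI)
    fix y assume "y \<in> carrier B"
    then obtain x where x: "x \<in> carrier A" "y = p x" using ex[of y] by blast
    show "q (s y) \<in> carrier C" using x by (simp add: val)
    show "q (s (twist B y)) = twist C (q (s y))"
      using x hom_space_homsD(2)[OF p(1)] hom_space_homsD(2)[OF q(1)]
      by (metis val A.twist_closed)
    {
      fix z assume "z \<in> carrier B"
      then obtain w where w: "w \<in> carrier A" "z = p w" using ex[of z] by blast
      show "q (s (y \<oplus>\<^bsub>B\<^esub> z)) = q (s y) \<oplus>\<^bsub>C\<^esub> q (s z)"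
        using x w by (simp add: p.add[symmetric] val del: p.hom_add)
    }
    {
      fix a assume "a \<in> carrier K"
      then show "q (s (a \<odot>\<^bsub>B\<^esub> y)) = a \<odot>\<^bsub>C\<^esub> q (s y)"
        using x by (simp add: p.smult[symmetric] val q.smult)
    }
  qed
  moreover have "bij_betw (\<lambda>y. q (s y)) (carrier B) (carrier C)"
  proof (rule bij_betw_imageI)
    show "inj_on (\<lambda>y. q (s y)) (carrier B)"
      by (rule inj_onI) (metis s eq)
    have "(\<lambda>y. q (s y)) ` p ` carrier A = q ` carrier A"
      using val by (auto simp: image_image)
    then show "(\<lambda>y. q (s y)) ` carrier B = carrier C" by (simp add: p(2) q(2))
  qed
  ultimately show ?thesis using B C by (auto simp: hom_space_iso_def)
qed


section \<open>Commutator ideals\<close>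

context hom_leibniz_algebra
begin

lemma bracket_closed: "\<lbrakk>x \<in> carrier G; y \<in> carrier G\<rbrakk> \<Longrightarrow> bracket G x y \<in> carrier G"
  by (rule linear_mapsD(1)[OF bracket_linear_right])

definition brackets :: "'a set \<Rightarrow> 'a set"
  where "brackets I = {bracket G x y | x y. x \<in> carrier G \<and> y \<in> I} \<union>
    {bracket G y x | x y. x \<in> carrier G \<and> y \<in> I}"

lemma brackets_closed: "I \<subseteq> carrier G \<Longrightarrow> brackets I \<subseteq> carrier G"
  by (auto simp: brackets_def intro: bracket_closed)

lemma twist_span_brackets:
  assumes I: "I \<subseteq> carrier G" and tI: "\<And>x. x \<in> I \<Longrightarrow> twist G x \<in> I"
    and x: "x \<in> linear_span K G (brackets I)"
  shows "twist G x \<in> linear_span K G (brackets I)"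
proof -
  let ?S = "linear_span K G (brackets I)"
  interpret t: linear_map K G G "twist G" by (intro linear_mapI module_axioms twist_linear)
  have S: "submodule ?S K G" by (rule linear_span_submodule[OF brackets_closed[OF I]])
  have "?S \<subseteq> {x \<in> carrier G. twist G x \<in> ?S}"
  proof (rule linear_span_minimal[OF t.submodule_vimage[OF S]])
    have "twist G x \<in> brackets I" if x: "x \<in> brackets I" for x
    proof -
      consider (l) y z where "y \<in> carrier G" "z \<in> I" "x = bracket G y z"
        | (r) y z where "y \<in> carrier G" "z \<in> I" "x = bracket G z y"
        using x unfolding brackets_def by blast
      then show ?thesis
      proof cases
        case l
        then have "twist G x = bracket G (twist G y) (twist G z)"
          using twist_bracket I by blast
        then show ?thesis using l twist_closed tI unfolding brackets_def by blast
      next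
        case r
        then have "twist G x = bracket G (twist G z) (twist G y)"
          using twist_bracket I by blast
        then show ?thesis using r twist_closed tI unfolding brackets_def by blast
      qed
    qed
    then show "brackets I \<subseteq> {x \<in> carrier G. twist G x \<in> ?S}"
      using linear_span_superset[of "brackets I"] brackets_closed[OF I] by blast
  qed
  with x show ?thesis by blast
qed

text \<open>
  The span of the brackets is already a subalgebra: it lies in the ideal \<open>I\<close>, so the bracket of two
  of its elements is one of the spanning brackets.
\<close>
lemma commutator_eq_span:
  assumes I: "submodule I K G" and tI: "\<And>x. x \<in> I \<Longrightarrow> twist G x \<in> I"
    and ideal: "brackets I \<subseteq> I"
  shows "commutator K G (carrier G) I = linear_span K G (brackets I)"
proof
  let ?S = "linear_span K G (brackets I)"
  have I_sub: "I \<subseteq> carrier G" by (rule submoduleE[OF I])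
  have S: "submodule ?S K G" by (rule linear_span_submodule[OF brackets_closed[OF I_sub]])
  have S_sub: "?S \<subseteq> I" by (rule linear_span_minimal[OF I ideal])
  note br = linear_span_superset[of "brackets I"]
  have "bracket G x y \<in> ?S" if "x \<in> ?S" "y \<in> ?S" for x y
    using that S_sub I_sub br unfolding brackets_def by blast
  then have "hom_subalgebra K G ?S"
    using S twist_span_brackets[OF I_sub tI] unfolding hom_subalgebra_def by blast
  moreover have "bracket G h l \<in> ?S \<and> bracket G l h \<in> ?S" if "h \<in> carrier G" "l \<in> I" for h l
    using that br unfolding brackets_def by blast
  ultimately show "commutator K G (carrier G) I \<subseteq> ?S"
    unfolding commutator_def by blast
  show "?S \<subseteq> commutator K G (carrier G) I"
    unfolding commutator_def
  proof (rule Inter_greatest)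
    fix S' assume "S' \<in> {S. hom_subalgebra K G S \<and>
      (\<forall>h \<in> carrier G. \<forall>l \<in> I. bracket G h l \<in> S \<and> bracket G l h \<in> S)}"
    then show "?S \<subseteq> S'"
      by (intro linear_span_minimal) (auto simp: hom_subalgebra_def brackets_def)
  qed
qed

end


section \<open>Free Hom-Leibniz algebras\<close>

definition transport :: "('h \<Rightarrow> 'l) \<Rightarrow> ('k, 'h) hom_algebra \<Rightarrow> ('k, 'l) hom_algebra"
  where "transport j H = (let g = inv_into (carrier H) j in
    \<lparr>carrier = j ` carrier H, mult = undefined, one = undefined,
     zero = j \<zero>\<^bsub>H\<^esub>, add = (\<lambda>x y. j (g x \<oplus>\<^bsub>H\<^esub> g y)), smult = (\<lambda>a x. j (a \<odot>\<^bsub>H\<^esub> g x)),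
     twist = (\<lambda>x. j (twist H (g x))), bracket = (\<lambda>x y. j (bracket H (g x) (g y)))\<rparr>)"

lemma transport:
  assumes H: "hom_leibniz_algebra K H" and inj: "inj_on j (carrier H)"
  shows "hom_leibniz_algebra K (transport j H)"
    and "j \<in> hom_leibniz_homs K H (transport j H)"
    and "inv_into (carrier H) j \<in> hom_leibniz_homs K (transport j H) H"
proof -
  interpret H: hom_leibniz_algebra K H by fact
  have img: "j ` carrier H = carrier (transport j H)" by (simp add: transport_def Let_def)
  have lin: "j \<in> linear_maps K H (transport j H)"
    by (rule linear_mapsI) (auto simp: transport_def Let_def inv_into_f_f[OF inj])
  have zero: "j \<zero>\<^bsub>H\<^esub> = \<zero>\<^bsub>transport j H\<^esub>" by (simp add: transport_def Let_def)
  have tw: "j (twist H x) = twist (transport j H) (j x)" if "x \<in> carrier H" for x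
    using that by (simp add: transport_def Let_def inv_into_f_f[OF inj])
  have br: "j (bracket H x y) = bracket (transport j H) (j x) (j y)"
    if "x \<in> carrier H" "y \<in> carrier H" for x y
    using that by (simp add: transport_def Let_def inv_into_f_f[OF inj])
  show "hom_leibniz_algebra K (transport j H)" "j \<in> hom_leibniz_homs K H (transport j H)"
    by (rule hom_leibniz_algebra_image[OF H img zero lin tw br]; assumption)+
  show "inv_into (carrier H) j \<in> hom_leibniz_homs K (transport j H) H"
    by (auto simp: hom_leibniz_homs_def hom_space_homs_def linear_maps_def transport_def Let_def
        inv_into_f_f[OF inj] H.twist_closed H.bracket_closed)
qed

text \<open>
  The definition of freeness tests only algebras whose elements are lists over \<open>'k + 'v + 'f\<close>.  If
  some function \<open>D\<close> on such lists reaches all of \<open>H\<close>, then choosing preimages under \<open>D\<close> embeds \<open>H\<close>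
  into the type of lists, and both halves of the universal property can be transported back.
\<close>
lemma
  fixes K :: "('k, 'm) ring_scheme" and V :: "('k, 'v) hom_module" and F :: "('k, 'f) hom_algebra"
    and H :: "('k, 'h) hom_algebra" and D :: "('k + 'v + 'f) list \<Rightarrow> 'h"
  assumes free: "free_hom_leibniz K V i F" and H: "hom_leibniz_algebra K H"
    and small: "carrier H \<subseteq> range D"
  shows free_exists: "\<phi> \<in> hom_space_homs K V H \<Longrightarrow>
      \<exists>\<psi> \<in> hom_leibniz_homs K F H. \<forall>v \<in> carrier V. \<psi> (i v) = \<phi> v"
    and free_unique: "\<lbrakk>\<psi> \<in> hom_leibniz_homs K F H; \<psi>' \<in> hom_leibniz_homs K F H;
      \<And>v. v \<in> carrier V \<Longrightarrow> \<psi> (i v) = \<psi>' (i v); x \<in> carrier F\<rbrakk> \<Longrightarrow> \<psi> x = \<psi>' x"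
proof -
  define j where "j = inv_into UNIV D"
  have inj: "inj_on j (carrier H)"
    unfolding j_def by (rule inj_on_inv_into[OF small])
  let ?L = "transport j H"
  have i: "i \<in> hom_space_homs K V F" using free by (simp add: free_hom_leibniz_def)
  have all: "\<forall>(H :: ('k, ('k + 'v + 'f) list) hom_algebra) \<phi>.
      hom_leibniz_algebra K H \<longrightarrow> \<phi> \<in> hom_space_homs K V H \<longrightarrow>
      (\<exists>\<psi> \<in> hom_leibniz_homs K F H. (\<forall>v \<in> carrier V. \<psi> (i v) = \<phi> v) \<and>
        (\<forall>\<psi>' \<in> hom_leibniz_homs K F H.
          (\<forall>v \<in> carrier V. \<psi>' (i v) = \<phi> v) \<longrightarrow> (\<forall>x \<in> carrier F. \<psi>' x = \<psi> x)))"
    using free unfolding free_hom_leibniz_def by (elim conjE)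
  have univ: "\<exists>\<psi> \<in> hom_leibniz_homs K F ?L. (\<forall>v \<in> carrier V. \<psi> (i v) = \<phi> v) \<and>
      (\<forall>\<psi>' \<in> hom_leibniz_homs K F ?L.
        (\<forall>v \<in> carrier V. \<psi>' (i v) = \<phi> v) \<longrightarrow> (\<forall>x \<in> carrier F. \<psi>' x = \<psi> x))"
    if "\<phi> \<in> hom_space_homs K V ?L" for \<phi>
    by (rule all[THEN spec, THEN spec, THEN mp, THEN mp, OF transport(1)[OF H inj] that])
  note j = transport(2)[OF H inj] and g = transport(3)[OF H inj]
  {
    assume \<phi>: "\<phi> \<in> hom_space_homs K V H"
    have "(\<lambda>v. j (\<phi> v)) \<in> hom_space_homs K V ?L"
      by (rule hom_space_homs_comp[OF \<phi> hom_leibniz_homsD(1)[OF j]])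
    from univ[OF this] obtain \<psi> where
      \<psi>: "\<psi> \<in> hom_leibniz_homs K F ?L" "\<forall>v \<in> carrier V. \<psi> (i v) = j (\<phi> v)" by (elim bexE conjE)
    have "inv_into (carrier H) j (\<psi> (i v)) = \<phi> v" if "v \<in> carrier V" for v
      using that \<psi>(2) linear_mapsD(1)[OF hom_space_homsD(1)[OF \<phi>]] inv_into_f_f[OF inj] by metis
    then show "\<exists>\<psi> \<in> hom_leibniz_homs K F H. \<forall>v \<in> carrier V. \<psi> (i v) = \<phi> v"
      by (intro bexI[OF _ hom_leibniz_homs_comp[OF \<psi>(1) g]] ballI)
  }
  {
    assume \<psi>: "\<psi> \<in> hom_leibniz_homs K F H" and \<psi>': "\<psi>' \<in> hom_leibniz_homs K F H"
      and eq: "\<And>v. v \<in> carrier V \<Longrightarrow> \<psi> (i v) = \<psi>' (i v)" and x: "x \<in> carrier F"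
    have "(\<lambda>v. j (\<psi> (i v))) \<in> hom_space_homs K V ?L"
      using hom_space_homs_comp[OF i hom_leibniz_homsD(1)[OF hom_leibniz_homs_comp[OF \<psi> j]]] .
    from univ[OF this] obtain \<theta> where \<theta>: "\<forall>\<psi>' \<in> hom_leibniz_homs K F ?L.
        (\<forall>v \<in> carrier V. \<psi>' (i v) = j (\<psi> (i v))) \<longrightarrow> (\<forall>x \<in> carrier F. \<psi>' x = \<theta> x)"
      by (elim bexE conjE)
    have "j (\<psi> x) = \<theta> x"
      using bspec[OF \<theta> hom_leibniz_homs_comp[OF \<psi> j]] x by simp
    moreover have "j (\<psi>' x) = \<theta> x"
      using bspec[OF \<theta> hom_leibniz_homs_comp[OF \<psi>' j]] x eq by simp
    moreover have "\<psi> x \<in> carrier H" "\<psi>' x \<in> carrier H"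
      using \<psi> \<psi>' x hom_leibniz_homsD(1) hom_space_homsD(1) linear_mapsD(1) by metis+
    ultimately show "\<psi> x = \<psi>' x" using inj by (metis inj_onD)
  }
qed


section \<open>The chain complex\<close>

text \<open>
  Changing one entry of a tuple changes one entry of each face, through the bracket with a fixed
  element or through the twist.  This is why the differential is multilinear.
\<close>
lemma CL_face_update:
  assumes "length xs = n" "i < j" "j < n" "m < n"
  shows "CL_face G i j (xs[m := x]) =
    (if m = i then (CL_face G i j xs)[i := bracket G x (xs ! j)]
     else if m = j then (CL_face G i j xs)[i := bracket G (xs ! i) x]
     else (CL_face G i j xs)[(if m < j then m else m - 1) := twist G x])"
  using assms
  by (cases m j rule: linorder_cases; cases "m = i")
    (simp_all add: CL_face_def Let_def map_update take_update_swap drop_update_swap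
      list_update_append list_update_swap list_update_beyond min_def)

context hom_leibniz_algebra
begin

lemma tensor: "tensor K G"
  by (rule tensor.intro) (rule module_axioms)

lemma map_twist_tuples: "xs \<in> tuples G n \<Longrightarrow> map (twist G) xs \<in> tuples G n"
  using twist_closed by (auto simp: tuples_def)

lemma twist_tensor_multilinear:
  "multilinear K G n (tensor_power K G n) (\<lambda>xs. pure_tensor K G (map (twist G) xs))"
proof -
  interpret tensor K G n by (rule tensor)
  have "(\<lambda>x. pure_tensor K G (map (twist G) (xs[i := x]))) \<in> linear_maps K G (tensor_power K G n)"
    if "xs \<in> tuples G n" "i < n" for xs i
    using pure_tensor_multilinear that
    unfolding multilinear_def map_update
    by (intro linear_maps_comp[OF twist_linear]) (blast intro: map_twist_tuples)
  then show ?thesis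
    unfolding multilinear_def by (blast intro: map_twist_tuples pure_tensor_closed)
qed

lemma CL_twist_pure:
  "xs \<in> tuples G n \<Longrightarrow> twist (CL K G n) (pure_tensor K G xs) = pure_tensor K G (map (twist G) xs)"
proof -
  interpret tensor K G n by (rule tensor)
  show "xs \<in> tuples G n \<Longrightarrow> twist (CL K G n) (pure_tensor K G xs) = pure_tensor K G (map (twist G) xs)"
    by (simp add: CL_def tensor_lift_pure[OF tensor_power twist_tensor_multilinear])
qed

lemma CL: "hom_vector_space K (CL K G n)"
proof -
  interpret tensor K G n by (rule tensor)
  show ?thesis
    unfolding CL_def
    using linear_map.linear[OF tensor_lift[OF tensor_power twist_tensor_multilinear]] tensor_power
    by (intro hom_vector_space_with_twist)
qed

lemma linear_map_CL: "linear_map K (CL K G n) B f \<longleftrightarrow> linear_map K (tensor_power K G n) B f"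
proof -
  interpret tensor K G n by (rule tensor)
  have "module K (CL K G n)" using CL by (simp add: hom_vector_space_def)
  then show ?thesis
    using tensor_power by (auto simp: linear_map_def linear_map_axioms_def CL_def)
qed

lemma CL_face_tuples:
  assumes "i < j" "j < n" and xs: "xs \<in> tuples G n"
  shows "CL_face G i j xs \<in> tuples G (n - 1)"
proof -
  let ?ys = "(map (twist G) xs)[i := bracket G (xs ! i) (xs ! j)]"
  have "bracket G (xs ! i) (xs ! j) \<in> carrier G"
    using xs assms(1,2) by (intro bracket_closed) (auto simp: tuples_def)
  then have "?ys \<in> tuples G n"
    by (intro tuples_update map_twist_tuples xs)
  then show ?thesis
    using assms(1,2) set_take_subset[of j ?ys] set_drop_subset[of "Suc j" ?ys]
    by (auto simp: CL_face_def Let_def tuples_def)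
qed

lemma CL_face_multilinear:
  assumes "i < j" "j < n"
  shows "multilinear K G n (tensor_power K G (n - 1)) (\<lambda>xs. pure_tensor K G (CL_face G i j xs))"
proof -
  interpret tensor K G "n - 1" by (rule tensor)
  have "(\<lambda>x. pure_tensor K G (CL_face G i j (xs[m := x]))) \<in> linear_maps K G (tensor_power K G (n - 1))"
    if xs: "xs \<in> tuples G n" and m: "m < n" for xs m
  proof -
    have len: "length xs = n" and mem: "\<And>k. k < n \<Longrightarrow> xs ! k \<in> carrier G"
      using xs by (auto simp: tuples_def)
    have lin: "(\<lambda>x. pure_tensor K G ((CL_face G i j xs)[k := g x])) \<in> linear_maps K G (tensor_power K G (n - 1))"
      if "k < n - 1" "g \<in> linear_maps K G G" for k g
      using linear_maps_comp[OF that(2)] pure_tensor_multilinear CL_face_tuples[OF assms xs] that(1)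
      unfolding multilinear_def by blast
    note update = CL_face_update[OF len assms m]
    consider "m = i" | "m \<noteq> i" "m = j" | "m \<noteq> i" "m \<noteq> j" by blast
    then show ?thesis
    proof cases
      case 1
      show ?thesis
        unfolding update if_P[OF 1]
        by (intro lin bracket_linear_left mem) (use assms in auto)
    next
      case 2
      show ?thesis
        unfolding update if_not_P[OF 2(1)] if_P[OF 2(2)]
        by (intro lin bracket_linear_right mem) (use assms in auto)
    next
      case 3
      show ?thesis
        unfolding update if_not_P[OF 3(1)] if_not_P[OF 3(2)]
        by (intro lin twist_linear) (use 3 assms m in auto)
    qed
  qed
  then show ?thesis
    unfolding multilinear_def using pure_tensor_closed CL_face_tuples[OF assms] by blast
qed

text \<open>
  The value of the differential \<open>CL_d K G n\<close> on the pure tensor of \<open>xs\<close>, see \<open>CL_d_pure\<close>.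
\<close>
definition boundary :: "nat \<Rightarrow> 'a list \<Rightarrow> ('a list \<Rightarrow> 'k) set"
  where "boundary n xs = (\<Oplus>\<^bsub>tensor_power K G (n - 1)\<^esub>p\<in>{(i, j). i < j \<and> j < n}.
    ((\<ominus>\<^bsub>K\<^esub> \<one>\<^bsub>K\<^esub>) [^]\<^bsub>K\<^esub> snd p) \<odot>\<^bsub>tensor_power K G (n - 1)\<^esub> pure_tensor K G (CL_face G (fst p) (snd p) xs))"

lemma finite_faces: "finite {(i, j). i < j \<and> j < (n :: nat)}"
  by (rule finite_subset[of _ "{..<n} \<times> {..<n}"]) auto

lemma sign_closed: "(\<ominus>\<^bsub>K\<^esub> \<one>\<^bsub>K\<^esub>) [^]\<^bsub>K\<^esub> (k :: nat) \<in> carrier K"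
  by simp

lemma boundary_multilinear: "multilinear K G n (tensor_power K G (n - 1)) (boundary n)"
proof -
  interpret tensor K G "n - 1" by (rule tensor)
  interpret N: module K "tensor_power K G (n - 1)" by (rule tensor_power)
  have face: "pure_tensor K G (CL_face G (fst p) (snd p) xs) \<in> carrier (tensor_power K G (n - 1))"
    if "xs \<in> tuples G n" "p \<in> {(i, j). i < j \<and> j < n}" for xs p
    using that by (intro pure_tensor_closed CL_face_tuples) auto
  show ?thesis
    unfolding multilinear_def
  proof (intro conjI ballI allI impI)
    show "boundary n \<in> tuples G n \<rightarrow> carrier (tensor_power K G (n - 1))"
      unfolding boundary_def by (intro funcsetI N.M.finsum_closed N.smult_closed sign_closed face)
  next
    fix xs m assume xs: "xs \<in> tuples G n" and m: "m < n"
    show "(\<lambda>x. boundary n (xs[m := x])) \<in> linear_maps K G (tensor_power K G (n - 1))"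
      unfolding boundary_def
    proof (intro linear_maps_finsum linear_maps_smult N.module_axioms finite_faces sign_closed)
      fix p assume "p \<in> {(i, j). i < j \<and> j < n}"
      then have "multilinear K G n (tensor_power K G (n - 1))
          (\<lambda>xs. pure_tensor K G (CL_face G (fst p) (snd p) xs))"
        by (intro CL_face_multilinear) auto
      then show "(\<lambda>x. pure_tensor K G (CL_face G (fst p) (snd p) (xs[m := x])))
          \<in> linear_maps K G (tensor_power K G (n - 1))"
        using xs m by (simp only: multilinear_def)
    qed
  qed
qed

lemma CL_d_linear: "linear_map K (CL K G n) (CL K G (n - 1)) (CL_d K G n)"
  and CL_d_pure: "xs \<in> tuples G n \<Longrightarrow> CL_d K G n (pure_tensor K G xs) = boundary n xs"
proof -
  interpret t: tensor K G n by (rule tensor)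
  interpret t': tensor K G "n - 1" by (rule tensor)
  have d: "CL_d K G n = tensor_lift K (tensor_power K G (n - 1)) (boundary n)"
    by (simp add: CL_d_def boundary_def[abs_def] Let_def)
  show "linear_map K (CL K G n) (CL K G (n - 1)) (CL_d K G n)"
    unfolding d CL_def
    by (rule linear_map_with_twist[OF t.tensor_lift[OF t'.tensor_power boundary_multilinear]])
  show "xs \<in> tuples G n \<Longrightarrow> CL_d K G n (pure_tensor K G xs) = boundary n xs"
    unfolding d by (rule t.tensor_lift_pure[OF t'.tensor_power boundary_multilinear])
qed

text \<open>
  Multiplicativity of the twist makes it commute with the faces, and hence with the differential.
\<close>
lemma map_twist_CL_face:
  assumes "i < j" "j < n" "xs \<in> tuples G n"
  shows "map (twist G) (CL_face G i j xs) = CL_face G i j (map (twist G) xs)"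
proof -
  have "xs ! i \<in> carrier G" "xs ! j \<in> carrier G" "length xs = n"
    using assms by (auto simp: tuples_def)
  then show ?thesis
    using assms(1,2) by (simp add: CL_face_def Let_def map_update take_map[symmetric] drop_map[symmetric] twist_bracket)
qed

lemma CL_d_hom: "CL_d K G n \<in> hom_space_homs K (CL K G n) (CL K G (n - 1))"
proof -
  interpret t: tensor K G n by (rule tensor)
  interpret t': tensor K G "n - 1" by (rule tensor)
  interpret C: hom_vector_space K "CL K G n" by (rule CL)
  interpret C': hom_vector_space K "CL K G (n - 1)" by (rule CL)
  interpret d: linear_map K "CL K G n" "CL K G (n - 1)" "CL_d K G n" by (rule CL_d_linear)
  interpret tw: linear_map K "CL K G (n - 1)" "CL K G (n - 1)" "twist (CL K G (n - 1))"
    by (intro linear_mapI C'.module_axioms C'.twist_linear)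
  have tw_boundary: "twist (CL K G (n - 1)) (boundary n xs) = boundary n (map (twist G) xs)"
    if xs: "xs \<in> tuples G n" for xs
  proof -
    let ?N = "CL K G (n - 1)"
    let ?c = "\<lambda>p. (\<ominus>\<^bsub>K\<^esub> \<one>\<^bsub>K\<^esub>) [^]\<^bsub>K\<^esub> snd p"
    let ?P = "{(i, j). i < j \<and> j < n}"
    have N: "boundary n xs = (\<Oplus>\<^bsub>?N\<^esub>p\<in>?P. ?c p \<odot>\<^bsub>?N\<^esub> pure_tensor K G (CL_face G (fst p) (snd p) xs))" for xs
      by (simp add: boundary_def CL_def finsum_def finprod_def)
    have face: "CL_face G (fst p) (snd p) xs \<in> tuples G (n - 1)" if "p \<in> ?P" for p
      using that xs by (intro CL_face_tuples) auto
    have pure: "pure_tensor K G ys \<in> carrier ?N" if "ys \<in> tuples G (n - 1)" for ys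
      using t'.pure_tensor_closed[OF that] by (simp add: CL_def)
    have "twist ?N (boundary n xs) =
        (\<Oplus>\<^bsub>?N\<^esub>p\<in>?P. twist ?N (?c p \<odot>\<^bsub>?N\<^esub> pure_tensor K G (CL_face G (fst p) (snd p) xs)))"
      unfolding N by (rule tw.map_finsum[OF finite_faces])
        (intro C'.smult_closed sign_closed pure face)
    also have "\<dots> = (\<Oplus>\<^bsub>?N\<^esub>p\<in>?P. ?c p \<odot>\<^bsub>?N\<^esub> pure_tensor K G (CL_face G (fst p) (snd p) (map (twist G) xs)))"
    proof (rule C'.M.add.finprod_cong')
      fix p assume p: "p \<in> ?P"
      have "twist ?N (?c p \<odot>\<^bsub>?N\<^esub> pure_tensor K G (CL_face G (fst p) (snd p) xs))
          = ?c p \<odot>\<^bsub>?N\<^esub> pure_tensor K G (map (twist G) (CL_face G (fst p) (snd p) xs))"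
        by (simp only: tw.smult[OF sign_closed pure[OF face[OF p]]] CL_twist_pure[OF face[OF p]])
      then show "twist ?N (?c p \<odot>\<^bsub>?N\<^esub> pure_tensor K G (CL_face G (fst p) (snd p) xs))
          = ?c p \<odot>\<^bsub>?N\<^esub> pure_tensor K G (CL_face G (fst p) (snd p) (map (twist G) xs))"
        using p map_twist_CL_face[of "fst p" "snd p", OF _ _ xs] by (simp only: mem_Collect_eq split_beta)
    next
      show "(\<lambda>p. ?c p \<odot>\<^bsub>?N\<^esub> pure_tensor K G (CL_face G (fst p) (snd p) (map (twist G) xs))) \<in> ?P \<rightarrow> carrier ?N"
        by (intro funcsetI C'.smult_closed sign_closed pure CL_face_tuples map_twist_tuples xs) auto
    qed simp
    finally show ?thesis by (simp only: N)
  qed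
  have "CL_d K G n (twist (CL K G n) t) = twist (CL K G (n - 1)) (CL_d K G n t)"
    if t: "t \<in> carrier (CL K G n)" for t
  proof (rule t.tensor_power_maps_eq[of "CL K G (n - 1)" "\<lambda>t. CL_d K G n (twist (CL K G n) t)"])
    show "linear_map K (tensor_power K G n) (CL K G (n - 1)) (\<lambda>t. CL_d K G n (twist (CL K G n) t))"
      unfolding linear_map_CL[symmetric]
      by (intro linear_mapI C.module_axioms C'.module_axioms linear_maps_comp[OF C.twist_linear d.linear])
    show "linear_map K (tensor_power K G n) (CL K G (n - 1)) (\<lambda>t. twist (CL K G (n - 1)) (CL_d K G n t))"
      unfolding linear_map_CL[symmetric]
      by (intro linear_mapI C.module_axioms C'.module_axioms linear_maps_comp[OF d.linear C'.twist_linear])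
    show "t \<in> carrier (tensor_power K G n)" using t by (simp add: CL_def)
  qed (simp only: CL_twist_pure CL_d_pure map_twist_tuples tw_boundary)
  then show ?thesis
    using d.linear by (simp add: hom_space_homs_def)
qed

end


section \<open>The universal Leibniz pairing\<close>

text \<open>
  With \<open>w\<close> written as \<open>x \<circ> y\<close>, the last axiom is the Hom-Leibniz identity in which the outer
  bracket of each term is replaced by \<open>\<circ>\<close>.
\<close>
locale leibniz_pairing = G: hom_leibniz_algebra K G + Q: module K Q
  for K (structure) and G :: "('k, 'g, 'x) hom_algebra_scheme" and Q :: "('k, 'q, 'y) module_scheme" +
  fixes w :: "'g \<Rightarrow> 'g \<Rightarrow> 'q"
  assumes left: "y \<in> carrier G \<Longrightarrow> (\<lambda>x. w x y) \<in> linear_maps K G Q"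
    and right: "x \<in> carrier G \<Longrightarrow> w x \<in> linear_maps K G Q"
    and leibniz: "\<lbrakk>x \<in> carrier G; y \<in> carrier G; z \<in> carrier G\<rbrakk> \<Longrightarrow>
      w (twist G x) (bracket G y z) =
        w (bracket G x y) (twist G z) \<ominus>\<^bsub>Q\<^esub> w (bracket G x z) (twist G y)"
begin

lemma pairing_closed: "\<lbrakk>x \<in> carrier G; y \<in> carrier G\<rbrakk> \<Longrightarrow> w x y \<in> carrier Q"
  by (rule linear_mapsD(1)[OF right])

end

context hom_leibniz_algebra
begin

lemma bracket_pairing: "leibniz_pairing K G G (bracket G)"
  by unfold_locales (auto intro: bracket_linear_left bracket_linear_right hom_leibniz_identity)

text \<open>
  The cokernel of the differential from degree 3 to degree 2: the target of the universal Leibniz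
  pairing on \<open>G\<close>.
\<close>
definition leibniz_square :: "('k, ('a list \<Rightarrow> 'k) set set) hom_module"
  where "leibniz_square = quot_hom_space (CL K G 2) (CL_d K G 3 ` carrier (CL K G 3))"

definition pair :: "'a \<Rightarrow> 'a \<Rightarrow> ('a list \<Rightarrow> 'k) set set"
  where "pair x y = (CL_d K G 3 ` carrier (CL K G 3)) +>\<^bsub>CL K G 2\<^esub> pure_tensor K G [x, y]"

lemma tuples_2: "xs \<in> tuples G 2 \<longleftrightarrow> (\<exists>x \<in> carrier G. \<exists>y \<in> carrier G. xs = [x, y])"
  by (auto simp: tuples_def length_Suc_conv numeral_2_eq_2)

lemma tuples_3:
  "xs \<in> tuples G 3 \<longleftrightarrow> (\<exists>x \<in> carrier G. \<exists>y \<in> carrier G. \<exists>z \<in> carrier G. xs = [x, y, z])"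
  by (auto simp: tuples_def length_Suc_conv numeral_3_eq_3)

lemma pure_tensor_CL: "xs \<in> tuples G n \<Longrightarrow> pure_tensor K G xs \<in> carrier (CL K G n)"
  using tensor.pure_tensor_closed[OF tensor] by (simp add: CL_def)

lemma pure_tensor_slot:
  assumes "xs \<in> tuples G n" "i < n"
  shows "(\<lambda>x. pure_tensor K G (xs[i := x])) \<in> linear_maps K G (CL K G n)"
  using tensor.pure_tensor_multilinear[OF tensor, of n] assms
  by (simp add: CL_def multilinear_def)

lemma CL_maps_eq:
  assumes "linear_map K (CL K G n) N f" "linear_map K (CL K G n) N g"
    and "\<And>xs. xs \<in> tuples G n \<Longrightarrow> f (pure_tensor K G xs) = g (pure_tensor K G xs)"
    and "t \<in> carrier (CL K G n)"
  shows "f t = g t"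
  by (rule tensor.tensor_power_maps_eq[OF tensor assms(1,2)[unfolded linear_map_CL] assms(3)])
    (use assms(4) in \<open>simp_all add: CL_def\<close>)

lemma CL_module: "module K (CL K G n)"
  using CL by (simp add: hom_vector_space_def)

lemma sign_1: "(\<ominus>\<^bsub>K\<^esub> \<one>\<^bsub>K\<^esub>) [^]\<^bsub>K\<^esub> (1 :: nat) = \<ominus>\<^bsub>K\<^esub> \<one>\<^bsub>K\<^esub>"
  by simp

lemma CL_face_2: "CL_face G 0 1 [x, y] = [bracket G x y]"
  by (simp add: CL_face_def)

lemma CL_face_3:
  "CL_face G 0 1 [x, y, z] = [bracket G x y, twist G z]"
  "CL_face G 0 2 [x, y, z] = [bracket G x z, twist G y]"
  "CL_face G 1 2 [x, y, z] = [twist G x, bracket G y z]"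
  by (simp_all add: CL_face_def)

lemma boundary_2:
  assumes "x \<in> carrier G" "y \<in> carrier G"
  shows "boundary 2 [x, y] = \<ominus>\<^bsub>CL K G 1\<^esub> pure_tensor K G [bracket G x y]"
proof -
  interpret C: module K "CL K G 1" by (rule CL_module)
  have faces: "{(i, j). i < j \<and> j < (2 :: nat)} = {(0, 1)}" by auto
  have "[bracket G x y] \<in> tuples G 1" using assms bracket_closed by (auto simp: tuples_def)
  note pure_tensor_CL[OF this]
  moreover have "boundary 2 [x, y] = (\<Oplus>\<^bsub>CL K G 1\<^esub>p\<in>{(0, 1)}. ((\<ominus>\<^bsub>K\<^esub> \<one>\<^bsub>K\<^esub>) [^]\<^bsub>K\<^esub> (snd p :: nat))
      \<odot>\<^bsub>CL K G 1\<^esub> pure_tensor K G (CL_face G (fst p) (snd p) [x, y]))"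
    unfolding boundary_def faces by (simp add: CL_def finsum_def finprod_def)
  ultimately show ?thesis
    by (simp add: CL_face_2 sign_1 C.smult_l_minus del: One_nat_def)
qed

lemma boundary_3:
  assumes "x \<in> carrier G" "y \<in> carrier G" "z \<in> carrier G"
  shows "boundary 3 [x, y, z] =
    \<ominus>\<^bsub>CL K G 2\<^esub> pure_tensor K G [bracket G x y, twist G z] \<oplus>\<^bsub>CL K G 2\<^esub>
      (pure_tensor K G [bracket G x z, twist G y] \<oplus>\<^bsub>CL K G 2\<^esub>
       pure_tensor K G [twist G x, bracket G y z])"
proof -
  interpret C: module K "CL K G 2" by (rule CL_module)
  have faces: "{(i, j). i < j \<and> j < (3 :: nat)} = {(0, 1), (0, 2), (1, 2)}" by auto
  have closed: "pure_tensor K G [bracket G x y, twist G z] \<in> carrier (CL K G 2)"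
    "pure_tensor K G [bracket G x z, twist G y] \<in> carrier (CL K G 2)"
    "pure_tensor K G [twist G x, bracket G y z] \<in> carrier (CL K G 2)"
    using assms by (auto intro!: pure_tensor_CL simp: tuples_2 bracket_closed twist_closed)
  have "(\<ominus>\<^bsub>K\<^esub> \<one>\<^bsub>K\<^esub>) [^]\<^bsub>K\<^esub> (2 :: nat) = \<one>\<^bsub>K\<^esub>"
    by (simp add: numeral_2_eq_2 l_minus r_minus)
  moreover have "boundary 3 [x, y, z] = (\<Oplus>\<^bsub>CL K G 2\<^esub>p\<in>{(0, 1), (0, 2), (1, 2)}. ((\<ominus>\<^bsub>K\<^esub> \<one>\<^bsub>K\<^esub>) [^]\<^bsub>K\<^esub> (snd p :: nat))
      \<odot>\<^bsub>CL K G 2\<^esub> pure_tensor K G (CL_face G (fst p) (snd p) [x, y, z]))"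
    unfolding boundary_def faces by (simp add: CL_def finsum_def finprod_def)
  ultimately show ?thesis
    using closed by (simp add: CL_face_3 sign_1 C.smult_l_minus del: One_nat_def)
qed

lemma CL_d_3: "linear_map K (CL K G 3) (CL K G 2) (CL_d K G 3)"
  using CL_d_linear[of 3] by simp

lemma boundaries_submodule: "submodule (CL_d K G 3 ` carrier (CL K G 3)) K (CL K G 2)"
  by (rule linear_map.submodule_image[OF CL_d_3 module.carrier_is_submodule[OF CL_module]])

lemma boundaries_twist:
  assumes "t \<in> CL_d K G 3 ` carrier (CL K G 3)"
  shows "twist (CL K G 2) t \<in> CL_d K G 3 ` carrier (CL K G 3)"
proof -
  obtain u where u: "u \<in> carrier (CL K G 3)" "t = CL_d K G 3 u" using assms by blast
  then have "twist (CL K G 2) t = CL_d K G 3 (twist (CL K G 3) u)"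
    using hom_space_homsD(2)[OF CL_d_hom[of 3]] by simp
  then show ?thesis
    using hom_vector_space.twist_closed[OF CL u(1)] by simp
qed

lemma leibniz_square: "hom_vector_space K leibniz_square"
  unfolding leibniz_square_def
  by (rule hom_vector_space.quot_hom_space[OF CL boundaries_submodule boundaries_twist])

lemma leibniz_square_coset:
  "(\<lambda>t. (CL_d K G 3 ` carrier (CL K G 3)) +>\<^bsub>CL K G 2\<^esub> t) \<in> hom_space_homs K (CL K G 2) leibniz_square"
  unfolding leibniz_square_def
  by (rule hom_vector_space.coset_hom[OF CL boundaries_submodule boundaries_twist])

lemma leibniz_square_coset_map:
  "linear_map K (CL K G 2) leibniz_square (\<lambda>t. (CL_d K G 3 ` carrier (CL K G 3)) +>\<^bsub>CL K G 2\<^esub> t)"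
  by (rule linear_map_hom_spaces[OF CL leibniz_square leibniz_square_coset])

lemma twist_pair:
  assumes "x \<in> carrier G" "y \<in> carrier G"
  shows "twist leibniz_square (pair x y) = pair (twist G x) (twist G y)"
  using assms hom_space_homsD(2)[OF leibniz_square_coset pure_tensor_CL[of "[x, y]"]]
  by (simp add: pair_def tuples_2 CL_twist_pure[of "[x, y]" 2])

text \<open>
  The boundary of \<open>x \<otimes> y \<otimes> z\<close> is \<open>- [x, y] \<otimes> \<alpha> z + [x, z] \<otimes> \<alpha> y + \<alpha> x \<otimes> [y, z]\<close>.  That its class
  vanishes is the identity required of a Leibniz pairing.
\<close>
lemma pair_pairing: "leibniz_pairing K G leibniz_square pair"
proof -
  let ?B = "CL_d K G 3 ` carrier (CL K G 3)"
  let ?q = "\<lambda>t. ?B +>\<^bsub>CL K G 2\<^esub> t"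
  interpret Q: hom_vector_space K leibniz_square by (rule leibniz_square)
  interpret q: linear_map K "CL K G 2" leibniz_square ?q by (rule leibniz_square_coset_map)
  interpret quot: quotient K "CL K G 2" ?B by (intro quotientI CL_module boundaries_submodule)
  show ?thesis
  proof (intro leibniz_pairing.intro leibniz_pairing_axioms.intro hom_leibniz_algebra_axioms Q.module_axioms)
    fix y assume y: "y \<in> carrier G"
    show "(\<lambda>x. pair x y) \<in> linear_maps K G leibniz_square"
      using linear_maps_comp[OF pure_tensor_slot[of "[y, y]" 2 0] q.linear] y
      by (simp add: pair_def tuples_2)
    show "pair y \<in> linear_maps K G leibniz_square"
      using linear_maps_comp[OF pure_tensor_slot[of "[y, y]" 2 1] q.linear] y
      by (simp add: pair_def[abs_def] tuples_2)
  next
    fix x y z assume xyz: "x \<in> carrier G" "y \<in> carrier G" "z \<in> carrier G"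
    let ?a = "pure_tensor K G [bracket G x y, twist G z]"
      and ?b = "pure_tensor K G [bracket G x z, twist G y]"
      and ?c = "pure_tensor K G [twist G x, bracket G y z]"
    have closed: "?a \<in> carrier (CL K G 2)" "?b \<in> carrier (CL K G 2)" "?c \<in> carrier (CL K G 2)"
      using xyz by (auto intro!: pure_tensor_CL simp: tuples_2 bracket_closed twist_closed)
    have "[x, y, z] \<in> tuples G 3" using xyz by (simp add: tuples_3)
    then have "boundary 3 [x, y, z] \<in> ?B"
      using CL_d_pure pure_tensor_CL by (metis imageI)
    then have "?q (boundary 3 [x, y, z]) = ?B"
      by (rule quot.a_rcos_const)
    then have "\<ominus>\<^bsub>leibniz_square\<^esub> ?q ?a \<oplus>\<^bsub>leibniz_square\<^esub> (?q ?b \<oplus>\<^bsub>leibniz_square\<^esub> ?q ?c) = \<zero>\<^bsub>leibniz_square\<^esub>"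
      using closed by (simp add: boundary_3[OF xyz]) (simp add: leibniz_square_def)
    then have "?q ?c = ?q ?a \<ominus>\<^bsub>leibniz_square\<^esub> ?q ?b"
      using closed by (subst (asm) Q.M.neg_add_add_eq_zero_iff) (simp_all add: q.closed)
    then show "pair (twist G x) (bracket G y z) =
        pair (bracket G x y) (twist G z) \<ominus>\<^bsub>leibniz_square\<^esub> pair (bracket G x z) (twist G y)"
      by (simp add: pair_def)
  qed
qed

lemma leibniz_square_spanned:
  assumes N: "submodule N K leibniz_square"
    and pair: "\<And>x y. \<lbrakk>x \<in> carrier G; y \<in> carrier G\<rbrakk> \<Longrightarrow> pair x y \<in> N"
  shows "carrier leibniz_square \<subseteq> N"
proof -
  let ?B = "CL_d K G 3 ` carrier (CL K G 3)"
  let ?q = "\<lambda>t. ?B +>\<^bsub>CL K G 2\<^esub> t"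
  interpret q: linear_map K "CL K G 2" leibniz_square ?q by (rule leibniz_square_coset_map)
  interpret q': linear_map K "tensor_power K G 2" leibniz_square ?q
    using linear_map_CL leibniz_square_coset_map by blast
  have "carrier (tensor_power K G 2) \<subseteq> {t \<in> carrier (tensor_power K G 2). ?q t \<in> N}"
  proof (rule tensor.tensor_power_spanned[OF tensor q'.submodule_vimage[OF N]])
    fix xs assume xs: "xs \<in> tuples G 2"
    then show "pure_tensor K G xs \<in> {t \<in> carrier (tensor_power K G 2). ?q t \<in> N}"
      using tensor.pure_tensor_closed[OF tensor xs] pair by (auto simp: tuples_2 pair_def)
  qed
  moreover have "carrier leibniz_square = ?q ` carrier (CL K G 2)"
    unfolding leibniz_square_def quot_hom_space_sel A_RCOSETS_def' by blast
  ultimately show ?thesis by (auto simp: CL_def)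
qed

text \<open>
  Conversely, a Leibniz pairing kills the boundaries of all pure tensors of degree 3, and these
  span the boundaries.
\<close>
lemma leibniz_square_lift:
  fixes N :: "('k, 'n, 'y) module_scheme"
  assumes "leibniz_pairing K G N f"
  obtains g where "linear_map K leibniz_square N g"
    and "\<And>x y. \<lbrakk>x \<in> carrier G; y \<in> carrier G\<rbrakk> \<Longrightarrow> g (pair x y) = f x y"
proof -
  let ?B = "CL_d K G 3 ` carrier (CL K G 3)"
  interpret f: leibniz_pairing K G N f by fact
  interpret t: tensor K G 2 by (rule tensor)
  interpret quot: quotient K "CL K G 2" ?B by (intro quotientI CL_module boundaries_submodule)
  interpret d: linear_map K "CL K G 3" "CL K G 2" "CL_d K G 3" by (rule CL_d_3)
  define h where "h = tensor_lift K N (\<lambda>xs. f (xs ! 0) (xs ! 1))"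
  have f: "multilinear K G 2 N (\<lambda>xs. f (xs ! 0) (xs ! 1))"
    unfolding multilinear_def
  proof (intro conjI ballI allI impI)
    fix xs i assume xs: "xs \<in> tuples G 2" and i: "i < (2 :: nat)"
    obtain x y where "xs = [x, y]" "x \<in> carrier G" "y \<in> carrier G" using xs by (auto simp: tuples_2)
    moreover have "i = 0 \<or> i = 1" using i by auto
    ultimately show "(\<lambda>x. f (xs[i := x] ! 0) (xs[i := x] ! 1)) \<in> linear_maps K G N"
      using f.left f.right by auto
  qed (auto simp: tuples_2 f.pairing_closed)
  interpret h: linear_map K "CL K G 2" N h
    unfolding h_def linear_map_CL by (rule t.tensor_lift[OF f.Q.module_axioms f])
  have h_pure: "h (pure_tensor K G [x, y]) = f x y" if "x \<in> carrier G" "y \<in> carrier G" for x y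
    unfolding h_def using t.tensor_lift_pure[OF f.Q.module_axioms f, of "[x, y]"] that by (simp add: tuples_2)
  have zero_map: "linear_map K (CL K G 3) N (\<lambda>_. \<zero>\<^bsub>N\<^esub>)"
    by (intro linear_mapI CL_module f.Q.module_axioms linear_mapsI) auto
  have hd_map: "linear_map K (CL K G 3) N (\<lambda>t. h (CL_d K G 3 t))"
    by (intro linear_mapI CL_module f.Q.module_axioms linear_maps_comp[OF d.linear h.linear])
  have hd: "h (CL_d K G 3 t) = \<zero>\<^bsub>N\<^esub>" if "t \<in> carrier (CL K G 3)" for t
  proof (rule CL_maps_eq[OF hd_map zero_map _ that])
    fix xs assume xs: "xs \<in> tuples G 3"
    then obtain x y z where xyz: "x \<in> carrier G" "y \<in> carrier G" "z \<in> carrier G" "xs = [x, y, z]"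
      by (auto simp: tuples_3)
    have cl: "bracket G x y \<in> carrier G" "bracket G x z \<in> carrier G" "bracket G y z \<in> carrier G"
      "twist G x \<in> carrier G" "twist G y \<in> carrier G" "twist G z \<in> carrier G"
      using xyz by (auto simp: bracket_closed twist_closed)
    have closed: "pure_tensor K G [bracket G x y, twist G z] \<in> carrier (CL K G 2)"
      "pure_tensor K G [bracket G x z, twist G y] \<in> carrier (CL K G 2)"
      "pure_tensor K G [twist G x, bracket G y z] \<in> carrier (CL K G 2)"
      using cl by (auto intro!: pure_tensor_CL simp: tuples_2)
    have "h (CL_d K G 3 (pure_tensor K G xs)) = \<ominus>\<^bsub>N\<^esub> f (bracket G x y) (twist G z) \<oplus>\<^bsub>N\<^esub>
        (f (bracket G x z) (twist G y) \<oplus>\<^bsub>N\<^esub> f (twist G x) (bracket G y z))"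
      using closed cl by (simp add: CL_d_pure[OF xs, unfolded xyz(4)] xyz(4) boundary_3[OF xyz(1-3)] h_pure)
    also have "\<dots> = \<zero>\<^bsub>N\<^esub>"
      using f.leibniz[OF xyz(1-3)] cl
      by (subst f.Q.M.neg_add_add_eq_zero_iff) (simp_all add: f.pairing_closed)
    finally show "h (CL_d K G 3 (pure_tensor K G xs)) = \<zero>\<^bsub>N\<^esub>" .
  qed
  then have null: "\<And>b. b \<in> ?B \<Longrightarrow> h b = \<zero>\<^bsub>N\<^esub>" by blast
  show thesis
  proof (rule that)
    show "linear_map K leibniz_square N (\<lambda>X. the_elem (h ` X))"
      unfolding leibniz_square_def quot_hom_space_def
      using quot.lift_linear[OF h.linear_map_axioms null]
      by (auto simp: linear_map_def linear_map_axioms_def module_with_twist)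
    show "the_elem (h ` pair x y) = f x y" if "x \<in> carrier G" "y \<in> carrier G" for x y
      unfolding pair_def using that
      by (subst quot.lift_coset[OF h.linear_map_axioms null])
        (auto simp: h_pure tuples_2 intro!: pure_tensor_CL)
  qed
qed

text \<open>
  The first tensor power is \<open>G\<close> itself; the inverse of the embedding lifts the map that takes a
  one-element list to its entry.
\<close>
lemma pure_tensor_1_eq_zero:
  assumes "x \<in> carrier G" "pure_tensor K G [x] = \<zero>\<^bsub>CL K G 1\<^esub>"
  shows "x = \<zero>\<^bsub>G\<^esub>"
proof -
  interpret t: tensor K G 1 by (rule tensor)
  have "multilinear K G 1 G hd"
    by (auto simp: multilinear_def tuples_def length_Suc_conv linear_maps_def)
  note t.tensor_lift[OF module_axioms this] t.tensor_lift_pure[OF module_axioms this, of "[x]"]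
  then interpret l: linear_map K "CL K G 1" G "tensor_lift K G hd"
    by (simp add: linear_map_CL)
  have "x = tensor_lift K G hd (pure_tensor K G [x])"
    using \<open>[x] \<in> tuples G 1 \<Longrightarrow> _\<close> assms(1) by (simp add: tuples_def)
  with assms(2) show ?thesis using l.hom_zero by metis
qed

text \<open>
  On pure tensors the differential of degree 2 is \<open>x \<otimes> y \<mapsto> - [x, y]\<close>, so it is \<open>- \<mu>\<close> on classes,
  followed by the embedding of \<open>G\<close> in its first tensor power.  The cycles are therefore the tensors
  whose class lies in the kernel of \<open>\<mu>\<close>.
\<close>
lemma HL_2_eq:
  assumes \<mu>: "linear_map K leibniz_square G \<mu>"
    and \<mu>_pair: "\<And>x y. \<lbrakk>x \<in> carrier G; y \<in> carrier G\<rbrakk> \<Longrightarrow> \<mu> (pair x y) = bracket G x y"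
  shows "HL K G 2 = leibniz_square\<lparr>carrier := {X \<in> carrier leibniz_square. \<mu> X = \<zero>\<^bsub>G\<^esub>}\<rparr>"
proof -
  let ?B = "CL_d K G 3 ` carrier (CL K G 3)"
  let ?q = "\<lambda>t. ?B +>\<^bsub>CL K G 2\<^esub> t"
  interpret \<mu>: linear_map K leibniz_square G \<mu> by fact
  interpret q: linear_map K "CL K G 2" leibniz_square ?q by (rule leibniz_square_coset_map)
  interpret d: linear_map K "CL K G 2" "CL K G 1" "CL_d K G 2"
    using CL_d_linear[of 2] by simp
  have emb: "(\<lambda>x. pure_tensor K G [x]) \<in> linear_maps K G (CL K G 1)"
    using pure_tensor_slot[of "[\<zero>\<^bsub>G\<^esub>]" 1 0] by (simp add: tuples_def)
  interpret e: linear_map K G "CL K G 1" "\<lambda>x. pure_tensor K G [x]"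
    by (intro linear_mapI module_axioms CL_module emb)
  interpret e\<mu>: linear_map K "CL K G 2" "CL K G 1" "\<lambda>t. (\<ominus>\<^bsub>K\<^esub> \<one>\<^bsub>K\<^esub>) \<odot>\<^bsub>CL K G 1\<^esub> pure_tensor K G [\<mu> (?q t)]"
    by (intro linear_mapI CL_module linear_maps_smult[OF CL_module
          linear_maps_comp[OF linear_maps_comp[OF q.linear \<mu>.linear] emb]]) simp
  have d: "CL_d K G 2 t = (\<ominus>\<^bsub>K\<^esub> \<one>\<^bsub>K\<^esub>) \<odot>\<^bsub>CL K G 1\<^esub> pure_tensor K G [\<mu> (?q t)]"
    if "t \<in> carrier (CL K G 2)" for t
  proof (rule CL_maps_eq[OF d.linear_map_axioms e\<mu>.linear_map_axioms _ that])
    fix xs assume xs: "xs \<in> tuples G 2"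
    then obtain x y where xy: "x \<in> carrier G" "y \<in> carrier G" "xs = [x, y]" by (auto simp: tuples_2)
    then show "CL_d K G 2 (pure_tensor K G xs) =
        (\<ominus>\<^bsub>K\<^esub> \<one>\<^bsub>K\<^esub>) \<odot>\<^bsub>CL K G 1\<^esub> pure_tensor K G [\<mu> (?q (pure_tensor K G xs))]"
      using \<mu>_pair[of x y]
      by (simp add: CL_d_pure[OF xs, unfolded xy(3)] boundary_2 pair_def[symmetric] d.cod.smult_l_minus e.closed bracket_closed del: One_nat_def)
  qed
  have "CL_d K G 2 t = \<zero>\<^bsub>CL K G 1\<^esub> \<longleftrightarrow> \<mu> (?q t) = \<zero>\<^bsub>G\<^esub>" if t: "t \<in> carrier (CL K G 2)" for t
  proof
    assume "CL_d K G 2 t = \<zero>\<^bsub>CL K G 1\<^esub>"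
    then have "\<ominus>\<^bsub>CL K G 1\<^esub> pure_tensor K G [\<mu> (?q t)] = \<zero>\<^bsub>CL K G 1\<^esub>"
      using d[OF t] t by (simp add: d.cod.smult_l_minus e.closed \<mu>.closed q.closed del: One_nat_def)
    then have "pure_tensor K G [\<mu> (?q t)] = \<zero>\<^bsub>CL K G 1\<^esub>"
      using t by (simp add: d.cod.M.add.inv_eq_1_iff e.closed \<mu>.closed q.closed del: One_nat_def)
    then show "\<mu> (?q t) = \<zero>\<^bsub>G\<^esub>"
      using t by (intro pure_tensor_1_eq_zero) (simp_all add: \<mu>.closed q.closed del: One_nat_def)
  next
    assume "\<mu> (?q t) = \<zero>\<^bsub>G\<^esub>"
    then show "CL_d K G 2 t = \<zero>\<^bsub>CL K G 1\<^esub>" using d[OF t] e.hom_zero by (simp del: One_nat_def)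
  qed
  then have ker: "a_kernel (CL K G 2) (CL K G 1) (CL_d K G 2) = {t \<in> carrier (CL K G 2). \<mu> (?q t) = \<zero>\<^bsub>G\<^esub>}"
    by (auto simp: a_kernel_def kernel_def)
  have "carrier leibniz_square = ?q ` carrier (CL K G 2)"
    unfolding leibniz_square_def quot_hom_space_sel A_RCOSETS_def' by blast
  then have "?q ` {t \<in> carrier (CL K G 2). \<mu> (?q t) = \<zero>\<^bsub>G\<^esub>} = {X \<in> carrier leibniz_square. \<mu> X = \<zero>\<^bsub>G\<^esub>}"
    by auto
  moreover have "HL K G 2 = quot_hom_space ((CL K G 2)\<lparr>carrier := a_kernel (CL K G 2) (CL K G 1) (CL_d K G 2)\<rparr>) ?B"
    by (simp add: HL_def eval_nat_numeral)
  ultimately show ?thesis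
    by (simp only: quot_hom_space_restrict ker leibniz_square_def)
qed

end


section \<open>Extensions by Leibniz pairings\<close>

text \<open>
  The extension of \<open>G\<close> by \<open>Q\<close> with cocycle \<open>w\<close>: brackets depend only on the first components, so \<open>Q\<close>
  is central.
\<close>
definition extension ::
    "('k, 'g, 'x) hom_algebra_scheme \<Rightarrow> ('k, 'q, 'y) hom_module_scheme \<Rightarrow> ('g \<Rightarrow> 'g \<Rightarrow> 'q) \<Rightarrow>
      ('k, 'g \<times> 'q) hom_algebra"
  where "extension G Q w =
    \<lparr>carrier = carrier G \<times> carrier Q, mult = undefined, one = undefined,
     zero = (\<zero>\<^bsub>G\<^esub>, \<zero>\<^bsub>Q\<^esub>),
     add = (\<lambda>u v. (fst u \<oplus>\<^bsub>G\<^esub> fst v, snd u \<oplus>\<^bsub>Q\<^esub> snd v)),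
     smult = (\<lambda>a u. (a \<odot>\<^bsub>G\<^esub> fst u, a \<odot>\<^bsub>Q\<^esub> snd u)),
     twist = (\<lambda>u. (twist G (fst u), twist Q (snd u))),
     bracket = (\<lambda>u v. (bracket G (fst u) (fst v), w (fst u) (fst v)))\<rparr>"

lemma extension_sel [simp]:
  "carrier (extension G Q w) = carrier G \<times> carrier Q"
  "zero (extension G Q w) = (\<zero>\<^bsub>G\<^esub>, \<zero>\<^bsub>Q\<^esub>)"
  "add (extension G Q w) u v = (fst u \<oplus>\<^bsub>G\<^esub> fst v, snd u \<oplus>\<^bsub>Q\<^esub> snd v)"
  "smult (extension G Q w) a u = (a \<odot>\<^bsub>G\<^esub> fst u, a \<odot>\<^bsub>Q\<^esub> snd u)"
  "twist (extension G Q w) u = (twist G (fst u), twist Q (snd u))"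
  "bracket (extension G Q w) u v = (bracket G (fst u) (fst v), w (fst u) (fst v))"
  by (simp_all add: extension_def)

text \<open>
  The Hom-Leibniz identity of the extension is, in the first component, that of \<open>G\<close> and, in the
  second component, the axiom \<open>leibniz\<close> of the pairing.
\<close>
lemma
  assumes "leibniz_pairing K G Q w" and "hom_vector_space K Q"
    and twist_w: "\<And>x y. \<lbrakk>x \<in> carrier G; y \<in> carrier G\<rbrakk> \<Longrightarrow>
      twist Q (w x y) = w (twist G x) (twist G y)"
  shows extension: "hom_leibniz_algebra K (extension G Q w)"
    and fst_extension: "fst \<in> hom_leibniz_homs K (extension G Q w) G"
    and snd_extension: "snd \<in> hom_space_homs K (extension G Q w) Q"
proof -
  interpret leibniz_pairing K G Q w by fact
  interpret Q: hom_vector_space K Q by fact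
  let ?E = "extension G Q w"
  interpret E: module K ?E
  proof (intro moduleI abelian_groupI)
    fix u assume "u \<in> carrier ?E"
    then show "\<exists>v\<in>carrier ?E. v \<oplus>\<^bsub>?E\<^esub> u = \<zero>\<^bsub>?E\<^esub>"
      by (intro bexI[of _ "(\<ominus>\<^bsub>G\<^esub> fst u, \<ominus>\<^bsub>Q\<^esub> snd u)"]) (auto simp: G.M.l_neg Q.M.l_neg)
  qed (auto simp: G.smult_l_distr G.smult_r_distr G.smult_assoc1 G.M.a_ac
      Q.smult_l_distr Q.smult_r_distr Q.smult_assoc1 Q.M.a_ac G.is_cring)
  interpret fst: linear_map K ?E G fst
    by (intro linear_mapI E.module_axioms G.module_axioms linear_mapsI) auto
  interpret snd: linear_map K ?E Q snd
    by (intro linear_mapI E.module_axioms Q.module_axioms linear_mapsI) auto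
  note lin = linear_mapsD[OF G.twist_linear] linear_mapsD[OF Q.twist_linear]
    linear_mapsD[OF G.bracket_linear_left] linear_mapsD[OF G.bracket_linear_right]
    linear_mapsD[OF left] linear_mapsD[OF right]
  show "hom_leibniz_algebra K ?E"
  proof (intro hom_leibniz_algebra.intro hom_vector_space.intro hom_vector_space_axioms.intro
      hom_leibniz_algebra_axioms.intro linear_mapsI G.field_axioms E.module_axioms)
    fix u v t assume "u \<in> carrier ?E" "v \<in> carrier ?E" "t \<in> carrier ?E"
    moreover from this have "bracket ?E (bracket ?E u v) (twist ?E t) \<in> carrier ?E"
      "bracket ?E (bracket ?E u t) (twist ?E v) \<in> carrier ?E"
      by (auto simp: lin)
    ultimately show "bracket ?E (twist ?E u) (bracket ?E v t) =
        bracket ?E (bracket ?E u v) (twist ?E t) \<ominus>\<^bsub>?E\<^esub> bracket ?E (bracket ?E u t) (twist ?E v)"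
      by (intro prod_eqI) (auto simp: fst.minus snd.minus G.hom_leibniz_identity leibniz
          simp del: extension_sel(1))
  qed (auto simp: lin G.twist_bracket twist_w)
  show "fst \<in> hom_leibniz_homs K ?E G"
    using fst.linear by (simp add: hom_leibniz_homs_def hom_space_homs_def)
  show "snd \<in> hom_space_homs K ?E Q"
    using snd.linear by (simp add: hom_space_homs_def)
qed


section \<open>Spans as lists of coefficients\<close>

lemma (in module) linear_span_combination:
  assumes S: "S \<subseteq> carrier M" and x: "x \<in> linear_span R M S"
  shows "\<exists>ts. set ts \<subseteq> carrier R \<times> S \<and> x = foldr (\<lambda>(a, s) u. a \<odot>\<^bsub>M\<^esub> s \<oplus>\<^bsub>M\<^esub> u) ts \<zero>\<^bsub>M\<^esub>"
proof -
  define comb where "comb = (\<lambda>ts. foldr (\<lambda>(a, s) u. a \<odot>\<^bsub>M\<^esub> s \<oplus>\<^bsub>M\<^esub> u) ts \<zero>\<^bsub>M\<^esub>)"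
  have simps: "comb [] = \<zero>\<^bsub>M\<^esub>" "comb ((a, s) # ts) = a \<odot>\<^bsub>M\<^esub> s \<oplus>\<^bsub>M\<^esub> comb ts" for a s ts
    by (simp_all add: comb_def)
  let ?C = "comb ` {ts. set ts \<subseteq> carrier R \<times> S}"
  have closed: "comb ts \<in> carrier M" if "set ts \<subseteq> carrier R \<times> S" for ts
    using that S by (induction ts) (auto simp: simps)
  have append: "comb (ts @ us) = comb ts \<oplus>\<^bsub>M\<^esub> comb us"
    if "set ts \<subseteq> carrier R \<times> S" "set us \<subseteq> carrier R \<times> S" for ts us
    using that(1)
  proof (induction ts)
    case Nil
    then show ?case using closed[OF that(2)] by (simp add: simps)
  next
    case (Cons t ts)
    then show ?case using closed[OF that(2)] closed[of ts] S by (cases t) (auto simp: simps M.a_assoc subsetD)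
  qed
  have smult: "comb (map (\<lambda>(b, s). (a \<otimes> b, s)) ts) = a \<odot>\<^bsub>M\<^esub> comb ts"
    if "a \<in> carrier R" "set ts \<subseteq> carrier R \<times> S" for a ts
    using that(2)
  proof (induction ts)
    case Nil
    then show ?case using that(1) by (simp add: simps)
  next
    case (Cons t ts)
    then show ?case using that(1) closed[of ts] S
      by (cases t) (auto simp: simps smult_assoc1 smult_r_distr subsetD)
  qed
  have smult_mem: "a \<odot>\<^bsub>M\<^esub> y \<in> ?C" if a: "a \<in> carrier R" and y: "y \<in> ?C" for a y
  proof -
    obtain ts where ts: "set ts \<subseteq> carrier R \<times> S" "y = comb ts" using y by blast
    then have "set (map (\<lambda>(b, s). (a \<otimes> b, s)) ts) \<subseteq> carrier R \<times> S" using a by auto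
    then show ?thesis using smult[OF a ts(1)] ts(2) by (metis (mono_tags, lifting) imageI mem_Collect_eq)
  qed
  have "submodule ?C R M"
  proof (intro submoduleI)
    show "?C \<subseteq> carrier M" using closed by blast
    show "\<zero>\<^bsub>M\<^esub> \<in> ?C" by (rule image_eqI[of _ _ "[]"]) (auto simp: simps)
    show "\<ominus>\<^bsub>M\<^esub> y \<in> ?C" if y: "y \<in> ?C" for y
    proof -
      have "y \<in> carrier M" using y closed by blast
      then have "\<ominus>\<^bsub>M\<^esub> y = (\<ominus> \<one>) \<odot>\<^bsub>M\<^esub> y" by (simp add: smult_l_minus)
      then show ?thesis using smult_mem[OF _ y] by simp
    qed
    show "y \<oplus>\<^bsub>M\<^esub> z \<in> ?C" if "y \<in> ?C" "z \<in> ?C" for y z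
    proof -
      obtain ts us where "set ts \<subseteq> carrier R \<times> S" "y = comb ts" "set us \<subseteq> carrier R \<times> S" "z = comb us"
        using \<open>y \<in> ?C\<close> \<open>z \<in> ?C\<close> by blast
      then show ?thesis by (intro image_eqI[of _ _ "ts @ us"]) (simp_all add: append)
    qed
  qed (rule smult_mem)
  moreover have "S \<subseteq> ?C"
  proof
    fix s assume "s \<in> S"
    then show "s \<in> ?C" using S by (intro image_eqI[of _ _ "[(\<one>, s)]"]) (auto simp: simps)
  qed
  ultimately have "linear_span R M S \<subseteq> ?C" by (rule linear_span_minimal)
  then show ?thesis using x by (auto simp: comb_def)
qed

text \<open>
  Lists as codes for linear combinations of values of \<open>w\<close>, with three entries for each term.  They
  make an extension by the span of these values small enough for the test in the definition of
  freeness.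
\<close>
fun decode :: "('k, 'q, 'z) module_scheme \<Rightarrow> ('f \<Rightarrow> 'f \<Rightarrow> 'q) \<Rightarrow> ('k + 'v + 'f) list \<Rightarrow> 'q"
  where
    "decode Q w (a # b # c # l) =
      projl a \<odot>\<^bsub>Q\<^esub> w (projr (projr b)) (projr (projr c)) \<oplus>\<^bsub>Q\<^esub> decode Q w l"
  | "decode Q w _ = \<zero>\<^bsub>Q\<^esub>"

lemma (in module) linear_span_decode:
  fixes w :: "'f \<Rightarrow> 'f \<Rightarrow> 'c"
  assumes S: "{w x y | x y. x \<in> X \<and> y \<in> X} \<subseteq> carrier M"
    and t: "t \<in> linear_span R M {w x y | x y. x \<in> X \<and> y \<in> X}"
  shows "\<exists>l :: ('a + 'v + 'f) list. decode M w l = t"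
proof -
  let ?S = "{w x y | x y. x \<in> X \<and> y \<in> X}"
  obtain ts where ts: "set ts \<subseteq> carrier R \<times> ?S" "t = foldr (\<lambda>(a, s) u. a \<odot>\<^bsub>M\<^esub> s \<oplus>\<^bsub>M\<^esub> u) ts \<zero>\<^bsub>M\<^esub>"
    using linear_span_combination[OF S t] by blast
  have "\<exists>l :: ('a + 'v + 'f) list. decode M w l = foldr (\<lambda>(a, s) u. a \<odot>\<^bsub>M\<^esub> s \<oplus>\<^bsub>M\<^esub> u) ts \<zero>\<^bsub>M\<^esub>"
    using ts(1)
  proof (induction ts)
    case Nil
    show ?case by (rule exI[of _ "[]"]) simp
  next
    case (Cons p ts)
    then obtain l :: "('a + 'v + 'f) list" where
      l: "decode M w l = foldr (\<lambda>(a, s) u. a \<odot>\<^bsub>M\<^esub> s \<oplus>\<^bsub>M\<^esub> u) ts \<zero>\<^bsub>M\<^esub>" by auto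
    obtain a x y where p: "p = (a, w x y)" using Cons.prems by auto
    show ?case
      by (rule exI[of _ "Inl a # Inr (Inr x) # Inr (Inr y) # l"]) (simp add: l p)
  qed
  then show ?thesis using ts(2) by simp
qed


section \<open>Hopf's formula\<close>

text \<open>
  Brackets with elements of the kernel of \<open>\<pi>\<close> lie in \<open>C\<close>.  So the class modulo \<open>C\<close> of a
  bracket depends only on the images of its arguments under \<open>\<pi>\<close>, and all laws for \<open>f\<close> may be
  checked on representatives, where they are the laws of the bracket of \<open>F\<close>.
\<close>
lemma coset_pairing:
  fixes F :: "('k, 'f) hom_algebra" and G :: "('k, 'g) hom_algebra"
  assumes F: "hom_leibniz_algebra K F" and G: "hom_leibniz_algebra K G"
    and \<pi>: "\<pi> \<in> hom_leibniz_homs K F G" and surj: "\<pi> ` carrier F = carrier G"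
    and C: "submodule C K F"
    and CI: "\<And>x r. \<lbrakk>x \<in> carrier F; r \<in> carrier F; \<pi> r = \<zero>\<^bsub>G\<^esub>\<rbrakk> \<Longrightarrow>
      bracket F x r \<in> C \<and> bracket F r x \<in> C"
  obtains f where "leibniz_pairing K G (quot_module F C) f"
    and "\<And>x y. \<lbrakk>x \<in> carrier F; y \<in> carrier F\<rbrakk> \<Longrightarrow> f (\<pi> x) (\<pi> y) = C +>\<^bsub>F\<^esub> bracket F x y"
proof -
  interpret F: hom_leibniz_algebra K F by fact
  interpret G: hom_leibniz_algebra K G by fact
  interpret \<pi>: linear_map K F G \<pi>
    using \<pi> by (intro linear_map_hom_spaces F.hom_vector_space_axioms G.hom_vector_space_axioms)
      (auto dest: hom_leibniz_homsD)
  interpret q: quotient K F C by (intro quotientI F.module_axioms C)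
  interpret c: linear_map K F "quot_module F C" "\<lambda>x. C +>\<^bsub>F\<^esub> x" by (rule q.coset_map)
  note br = hom_leibniz_homsD(2)[OF \<pi>] and tw = hom_space_homsD(2)[OF hom_leibniz_homsD(1)[OF \<pi>]]
  define \<sigma> where "\<sigma> = inv_into (carrier F) \<pi>"
  have \<sigma>: "\<sigma> x \<in> carrier F" "\<pi> (\<sigma> x) = x" if "x \<in> carrier G" for x
    using that surj by (auto simp: \<sigma>_def inv_into_into f_inv_into_f)
  define f where "f x y = C +>\<^bsub>F\<^esub> bracket F (\<sigma> x) (\<sigma> y)" for x y
  have indep: "C +>\<^bsub>F\<^esub> bracket F x y = C +>\<^bsub>F\<^esub> bracket F x' y'"
    if x: "x \<in> carrier F" "x' \<in> carrier F" "\<pi> x = \<pi> x'"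
      and y: "y \<in> carrier F" "y' \<in> carrier F" "\<pi> y = \<pi> y'" for x y x' y'
  proof -
    interpret l: linear_map K F F "\<lambda>x. bracket F x y"
      by (intro linear_mapI F.module_axioms F.bracket_linear_left y)
    interpret r: linear_map K F F "bracket F x'"
      by (intro linear_mapI F.module_axioms F.bracket_linear_right x)
    have "\<pi> (x \<ominus>\<^bsub>F\<^esub> x') = \<zero>\<^bsub>G\<^esub>" "\<pi> (y \<ominus>\<^bsub>F\<^esub> y') = \<zero>\<^bsub>G\<^esub>"
      using x y by (simp_all add: \<pi>.minus G.M.minus_eq_zero_iff)
    then have "bracket F (x \<ominus>\<^bsub>F\<^esub> x') y \<in> C" "bracket F x' (y \<ominus>\<^bsub>F\<^esub> y') \<in> C"
      using CI x y by simp_all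
    then have "C +>\<^bsub>F\<^esub> bracket F x y = C +>\<^bsub>F\<^esub> bracket F x' y"
      "C +>\<^bsub>F\<^esub> bracket F x' y = C +>\<^bsub>F\<^esub> bracket F x' y'"
      using x y by (simp_all add: q.coset_eq_iff F.bracket_closed l.minus r.minus)
    then show ?thesis by simp
  qed
  have f: "f (\<pi> x) (\<pi> y) = C +>\<^bsub>F\<^esub> bracket F x y" if "x \<in> carrier F" "y \<in> carrier F" for x y
    unfolding f_def using that \<sigma> \<pi>.closed by (intro indep) auto
  have ex: "\<exists>a \<in> carrier F. x = \<pi> a" if "x \<in> carrier G" for x using that surj by auto
  have "leibniz_pairing K G (quot_module F C) f"
  proof (intro leibniz_pairing.intro leibniz_pairing_axioms.intro G.hom_leibniz_algebra_axioms
      q.quot_module)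
    fix y assume y: "y \<in> carrier G"
    obtain b where b: "b \<in> carrier F" "y = \<pi> b" using ex[OF y] by blast
    note L = linear_mapsD[OF linear_maps_comp[OF F.bracket_linear_left[OF b(1)] c.linear]]
    note R = linear_mapsD[OF linear_maps_comp[OF F.bracket_linear_right[OF b(1)] c.linear]]
    show "(\<lambda>x. f x y) \<in> linear_maps K G (quot_module F C)"
    proof (rule linear_mapsI)
      fix x assume x: "x \<in> carrier G"
      obtain a where a: "a \<in> carrier F" "x = \<pi> a" using ex[OF x] by blast
      show "f x y \<in> carrier (quot_module F C)" using a b L(1) by (simp only: f)
      show "f (k \<odot>\<^bsub>G\<^esub> x) y = k \<odot>\<^bsub>quot_module F C\<^esub> f x y" if k: "k \<in> carrier K" for k
        using a b L(3)[OF k a(1)] by (simp only: f \<pi>.smult[OF k, symmetric] F.smult_closed[OF k])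
      fix x' assume x': "x' \<in> carrier G"
      obtain a' where a': "a' \<in> carrier F" "x' = \<pi> a'" using ex[OF x'] by blast
      show "f (x \<oplus>\<^bsub>G\<^esub> x') y = f x y \<oplus>\<^bsub>quot_module F C\<^esub> f x' y"
        using a b a' L(2)[OF a(1) a'(1)] by (simp only: f \<pi>.add[symmetric] F.M.a_closed)
    qed
    show "f y \<in> linear_maps K G (quot_module F C)"
    proof (rule linear_mapsI)
      fix x assume x: "x \<in> carrier G"
      obtain a where a: "a \<in> carrier F" "x = \<pi> a" using ex[OF x] by blast
      show "f y x \<in> carrier (quot_module F C)" using a b R(1) by (simp only: f)
      show "f y (k \<odot>\<^bsub>G\<^esub> x) = k \<odot>\<^bsub>quot_module F C\<^esub> f y x" if k: "k \<in> carrier K" for k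
        using a b R(3)[OF k a(1)] by (simp only: f \<pi>.smult[OF k, symmetric] F.smult_closed[OF k])
      fix x' assume x': "x' \<in> carrier G"
      obtain a' where a': "a' \<in> carrier F" "x' = \<pi> a'" using ex[OF x'] by blast
      show "f y (x \<oplus>\<^bsub>G\<^esub> x') = f y x \<oplus>\<^bsub>quot_module F C\<^esub> f y x'"
        using a b a' R(2)[OF a(1) a'(1)] by (simp only: f \<pi>.add[symmetric] F.M.a_closed)
    qed
  next
    fix x y z assume "x \<in> carrier G" "y \<in> carrier G" "z \<in> carrier G"
    then obtain a b c where abc: "a \<in> carrier F" "b \<in> carrier F" "c \<in> carrier F"
      and xyz: "x = \<pi> a" "y = \<pi> b" "z = \<pi> c" using ex[of x] ex[of y] ex[of z] by blast
    have "f (twist G x) (bracket G y z) = C +>\<^bsub>F\<^esub> bracket F (twist F a) (bracket F b c)"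
      unfolding xyz using abc by (simp only: br[symmetric] tw[symmetric] f F.twist_closed F.bracket_closed)
    also have "\<dots> = (C +>\<^bsub>F\<^esub> bracket F (bracket F a b) (twist F c)) \<ominus>\<^bsub>quot_module F C\<^esub>
        (C +>\<^bsub>F\<^esub> bracket F (bracket F a c) (twist F b))"
      using abc by (simp only: F.hom_leibniz_identity c.minus F.twist_closed F.bracket_closed)
    also have "\<dots> = f (bracket G x y) (twist G z) \<ominus>\<^bsub>quot_module F C\<^esub> f (bracket G x z) (twist G y)"
      unfolding xyz using abc by (simp only: br[symmetric] tw[symmetric] f F.twist_closed F.bracket_closed)
    finally show "f (twist G x) (bracket G y z) =
        f (bracket G x y) (twist G z) \<ominus>\<^bsub>quot_module F C\<^esub> f (bracket G x z) (twist G y)" .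
  qed
  then show thesis using f by (rule that)
qed

text \<open>
  The map \<open>\<rho>\<close> is the second component of the homomorphism \<open>s\<close> from \<open>F\<close> to the extension of \<open>G\<close> by
  its Leibniz square that sends a generator \<open>i v\<close> to \<open>(\<pi> (i v), 0)\<close>.  The first component of \<open>s\<close> is \<open>\<pi>\<close>
  by uniqueness, and then the bracket of the extension gives the value of \<open>\<rho>\<close> on brackets.
\<close>
lemma lift_to_leibniz_square:
  fixes K :: "'k ring" and G :: "('k, 'g) hom_algebra" and F :: "('k, 'f) hom_algebra"
    and V :: "('k, 'v) hom_module"
  assumes free: "free_hom_leibniz K V i F" and G: "hom_leibniz_algebra K G"
    and \<pi>: "\<pi> \<in> hom_leibniz_homs K F G" and surj: "\<pi> ` carrier F = carrier G"
  obtains \<rho> where "\<rho> \<in> hom_space_homs K F (hom_leibniz_algebra.leibniz_square K G)"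
    and "\<And>x y. \<lbrakk>x \<in> carrier F; y \<in> carrier F\<rbrakk> \<Longrightarrow>
      \<rho> (bracket F x y) = hom_leibniz_algebra.pair K G (\<pi> x) (\<pi> y)"
proof -
  interpret G: hom_leibniz_algebra K G by fact
  interpret F: hom_leibniz_algebra K F using free by (simp add: free_hom_leibniz_def)
  let ?Q = "G.leibniz_square"
  interpret Q: hom_vector_space K ?Q by (rule G.leibniz_square)
  interpret pair: leibniz_pairing K G ?Q G.pair by (rule G.pair_pairing)
  let ?E = "extension G ?Q G.pair"
  have E: "hom_leibniz_algebra K ?E"
    by (rule extension[OF G.pair_pairing G.leibniz_square]) (rule G.twist_pair)
  have fst: "fst \<in> hom_leibniz_homs K ?E G"
    by (rule fst_extension[OF G.pair_pairing G.leibniz_square]) (rule G.twist_pair)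
  have snd: "snd \<in> hom_space_homs K ?E ?Q"
    by (rule snd_extension[OF G.pair_pairing G.leibniz_square]) (rule G.twist_pair)
  have i: "i \<in> hom_space_homs K V F" using free by (simp add: free_hom_leibniz_def)
  note \<pi>' = hom_leibniz_homsD(1)[OF \<pi>]
  note \<pi>i = hom_space_homs_comp[OF i \<pi>']
  \<comment> \<open>Elements of \<open>G\<close> are coded by preimages in \<open>F\<close>, and elements of the square by linear
    combinations of pairs, so freeness applies to \<open>G\<close> and to the extension.\<close>
  define D :: "('k + 'v + 'f) list \<Rightarrow> 'g" where "D l = \<pi> (projr (projr (hd l)))" for l
  have D: "carrier G \<subseteq> range D"
  proof
    fix x assume "x \<in> carrier G"
    then obtain a where "x = \<pi> a" using surj by auto
    then show "x \<in> range D" by (intro image_eqI[of _ _ "[Inr (Inr a)]"]) (auto simp: D_def)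
  qed
  define D' :: "('k + 'v + 'f) list \<Rightarrow> 'g \<times> ('g list \<Rightarrow> 'k) set set"
    where "D' l = (D l, decode ?Q (\<lambda>x y. G.pair (\<pi> x) (\<pi> y)) (tl l))" for l
  have D': "carrier ?E \<subseteq> range D'"
  proof
    fix u assume "u \<in> carrier ?E"
    then obtain x t where u: "u = (x, t)" "x \<in> carrier G" "t \<in> carrier ?Q" by auto
    obtain a where a: "x = \<pi> a" using u surj by auto
    let ?S = "{G.pair (\<pi> x) (\<pi> y) | x y. x \<in> carrier F \<and> y \<in> carrier F}"
    have S: "?S \<subseteq> carrier ?Q"
      using pair.pairing_closed linear_mapsD(1)[OF hom_space_homsD(1)[OF \<pi>']] by auto
    have "carrier ?Q \<subseteq> linear_span K ?Q ?S"
    proof (rule G.leibniz_square_spanned[OF Q.linear_span_submodule[OF S]])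
      fix x y assume "x \<in> carrier G" "y \<in> carrier G"
      then obtain a b where "a \<in> carrier F" "b \<in> carrier F" "x = \<pi> a" "y = \<pi> b"
        using surj by (metis imageE)
      then have "G.pair x y \<in> ?S" by blast
      then show "G.pair x y \<in> linear_span K ?Q ?S" by (rule subsetD[OF Q.linear_span_superset])
    qed
    then have "t \<in> linear_span K ?Q ?S" using u by blast
    then obtain l :: "('k + 'v + 'f) list" where "decode ?Q (\<lambda>x y. G.pair (\<pi> x) (\<pi> y)) l = t"
      using Q.linear_span_decode[OF S] by blast
    then show "u \<in> range D'"
      by (intro image_eqI[of _ _ "Inr (Inr a) # l"]) (simp_all add: D'_def D_def u a)
  qed
  have "(\<lambda>v. (\<pi> (i v), \<zero>\<^bsub>?Q\<^esub>)) \<in> hom_space_homs K V ?E"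
  proof -
    have tw0: "twist ?Q \<zero>\<^bsub>?Q\<^esub> = \<zero>\<^bsub>?Q\<^esub>"
      by (rule linear_maps_zero[OF Q.twist_linear Q.module_axioms Q.module_axioms])
    show ?thesis
      using linear_mapsD[OF hom_space_homsD(1)[OF \<pi>i]] hom_space_homsD(2)[OF \<pi>i] tw0
      by (auto simp: hom_space_homs_def intro!: linear_mapsI)
  qed
  from free_exists[OF free E D' this] obtain s where
    s: "s \<in> hom_leibniz_homs K F ?E" "\<forall>v \<in> carrier V. s (i v) = (\<pi> (i v), \<zero>\<^bsub>?Q\<^esub>)" by blast
  have fst_s: "fst (s x) = \<pi> x" if "x \<in> carrier F" for x
    by (rule free_unique[OF free G D hom_leibniz_homs_comp[OF s(1) fst] \<pi> _ that]) (simp add: s)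
  show thesis
  proof (rule that)
    show "(\<lambda>x. snd (s x)) \<in> hom_space_homs K F ?Q"
      by (rule hom_space_homs_comp[OF hom_leibniz_homsD(1)[OF s(1)] snd])
    show "snd (s (bracket F x y)) = G.pair (\<pi> x) (\<pi> y)" if "x \<in> carrier F" "y \<in> carrier F" for x y
      using that by (simp add: hom_leibniz_homsD(2)[OF s(1)] fst_s)
  qed
qed

theorem corollary4p5:
  fixes K :: "'k ring"
    and G :: "('k, 'g) hom_algebra"
    and V :: "('k, 'v) hom_module" and i :: "'v \<Rightarrow> 'f"
    and R :: "('k, 'r) hom_algebra" and \<iota> :: "'r \<Rightarrow> 'f"
    and F :: "('k, 'f) hom_algebra" and \<pi> :: "'f \<Rightarrow> 'g"
  assumes "field K"
    and "hom_leibniz_algebra K G"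
    and "free_presentation K V i R \<iota> F \<pi> G"
  shows "hom_space_iso K (HL K G 2) (schur_multiplier K F (\<iota> ` carrier R))"
proof -
  have free: "free_hom_leibniz K V i F" and exact: "short_exact K R \<iota> F \<pi> G"
    using assms(3) by (auto simp: free_presentation_def)
  interpret G: hom_leibniz_algebra K G by fact
  interpret F: hom_leibniz_algebra K F using free by (simp add: free_hom_leibniz_def)
  have \<pi>: "\<pi> \<in> hom_leibniz_homs K F G" and surj: "\<pi> ` carrier F = carrier G"
    using exact by (auto simp: short_exact_def)
  define I where "I = {x \<in> carrier F. \<pi> x = \<zero>\<^bsub>G\<^esub>}"
  have \<iota>R: "\<iota> ` carrier R = I"
    using exact by (auto simp: short_exact_def a_kernel_def kernel_def I_def)
  note br = hom_leibniz_homsD(2)[OF \<pi>] and \<pi>_hom = hom_leibniz_homsD(1)[OF \<pi>]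
  note tw = hom_space_homsD(2)[OF \<pi>_hom]
  interpret \<pi>: linear_map K F G \<pi>
    by (rule linear_map_hom_spaces[OF F.hom_vector_space_axioms G.hom_vector_space_axioms \<pi>_hom])
  let ?Q = "G.leibniz_square"
  interpret Q: hom_vector_space K ?Q by (rule G.leibniz_square)
  interpret pair: leibniz_pairing K G ?Q G.pair by (rule G.pair_pairing)
  have zero_G: "twist G \<zero>\<^bsub>G\<^esub> = \<zero>\<^bsub>G\<^esub>"
    "\<And>x. x \<in> carrier G \<Longrightarrow> bracket G x \<zero>\<^bsub>G\<^esub> = \<zero>\<^bsub>G\<^esub>"
    "\<And>x. x \<in> carrier G \<Longrightarrow> bracket G \<zero>\<^bsub>G\<^esub> x = \<zero>\<^bsub>G\<^esub>"
    using linear_maps_zero[OF _ G.module_axioms G.module_axioms] G.twist_linear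
      G.bracket_linear_right G.bracket_linear_left by blast+
  have zero_pair: "\<And>x. x \<in> carrier G \<Longrightarrow> G.pair x \<zero>\<^bsub>G\<^esub> = \<zero>\<^bsub>?Q\<^esub>"
    "\<And>x. x \<in> carrier G \<Longrightarrow> G.pair \<zero>\<^bsub>G\<^esub> x = \<zero>\<^bsub>?Q\<^esub>"
    using linear_maps_zero[OF _ G.module_axioms Q.module_axioms] pair.right pair.left by blast+

  have I: "submodule I K F"
    using \<pi>.submodule_vimage[OF G.submodule_zero] by (simp add: I_def)
  have I_sub: "I \<subseteq> carrier F" by (auto simp: I_def)
  have tI: "twist F x \<in> I" if "x \<in> I" for x
    using that zero_G by (auto simp: I_def F.twist_closed tw)
  have ideal: "F.brackets I \<subseteq> I"
    using zero_G by (auto simp: F.brackets_def I_def F.bracket_closed br \<pi>.closed)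
  have full: "F.brackets (carrier F) \<subseteq> carrier F"
    by (auto simp: F.brackets_def F.bracket_closed)
  define B where "B = linear_span K F (F.brackets (carrier F))"
  define C where "C = linear_span K F (F.brackets I)"
  have comm_B: "commutator K F (carrier F) (carrier F) = B"
    unfolding B_def by (rule F.commutator_eq_span[OF F.carrier_is_submodule F.twist_closed full])
  have comm_C: "commutator K F (carrier F) I = C"
    unfolding C_def by (rule F.commutator_eq_span[OF I tI ideal])
  have B: "submodule B K F"
    unfolding B_def by (rule F.linear_span_submodule[OF full])
  have C: "submodule C K F"
    unfolding C_def by (rule F.linear_span_submodule) (use ideal I_sub in blast)
  have B_sub: "B \<subseteq> carrier F" by (rule F.submoduleE(1)[OF B])
  have C_sub: "C \<subseteq> I" unfolding C_def by (rule F.linear_span_minimal[OF I ideal])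
  have tB: "twist F x \<in> B" if "x \<in> B" for x
    using F.twist_span_brackets[OF subset_refl F.twist_closed] that unfolding B_def by blast
  have tC: "twist F x \<in> C" if "x \<in> C" for x
    using F.twist_span_brackets[OF I_sub tI] that unfolding C_def by blast
  have br_B: "bracket F x y \<in> B" if "x \<in> carrier F" "y \<in> carrier F" for x y
    using that F.linear_span_superset[of "F.brackets (carrier F)"] unfolding B_def F.brackets_def by blast
  have br_C: "bracket F x r \<in> C \<and> bracket F r x \<in> C"
    if "x \<in> carrier F" "r \<in> carrier F" "\<pi> r = \<zero>\<^bsub>G\<^esub>" for x r
    using that F.linear_span_superset[of "F.brackets I"] unfolding C_def F.brackets_def I_def by blast

  obtain \<rho> where \<rho>: "\<rho> \<in> hom_space_homs K F ?Q"
    and \<rho>_br: "\<And>x y. \<lbrakk>x \<in> carrier F; y \<in> carrier F\<rbrakk> \<Longrightarrow> \<rho> (bracket F x y) = G.pair (\<pi> x) (\<pi> y)"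
    using lift_to_leibniz_square[OF free assms(2) \<pi> surj] by blast
  interpret \<rho>: linear_map K F ?Q \<rho>
    by (rule linear_map_hom_spaces[OF F.hom_vector_space_axioms Q.hom_vector_space_axioms \<rho>])
  obtain \<mu> where \<mu>: "linear_map K ?Q G \<mu>"
    and \<mu>_pair: "\<And>x y. \<lbrakk>x \<in> carrier G; y \<in> carrier G\<rbrakk> \<Longrightarrow> \<mu> (G.pair x y) = bracket G x y"
    using G.leibniz_square_lift[OF G.bracket_pairing] by blast
  interpret \<mu>: linear_map K ?Q G \<mu> by fact
  interpret q: quotient K F C by (intro quotientI F.module_axioms C)
  let ?q = "\<lambda>x. C +>\<^bsub>F\<^esub> x"
  obtain f where f: "leibniz_pairing K G (quot_module F C) f"
    "\<And>x y. \<lbrakk>x \<in> carrier F; y \<in> carrier F\<rbrakk> \<Longrightarrow> f (\<pi> x) (\<pi> y) = ?q (bracket F x y)"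
    using coset_pairing[OF F.hom_leibniz_algebra_axioms assms(2) \<pi> surj C br_C] by blast
  obtain \<theta> where \<theta>: "linear_map K ?Q (quot_module F C) \<theta>"
    and \<theta>_pair: "\<And>x y. \<lbrakk>x \<in> carrier G; y \<in> carrier G\<rbrakk> \<Longrightarrow> \<theta> (G.pair x y) = f x y"
    using G.leibniz_square_lift[OF f(1)] by blast
  interpret \<theta>: linear_map K ?Q "quot_module F C" \<theta> by fact

  \<comment> \<open>Linear maps on \<open>B\<close> are compared on brackets, which span it.\<close>
  have in_B: "\<exists>x \<in> carrier F. \<exists>y \<in> carrier F. b = bracket F x y" if "b \<in> F.brackets (carrier F)" for b
    using that unfolding F.brackets_def by blast
  have \<mu>\<rho>: "\<mu> (\<rho> b) = \<pi> b" if "b \<in> B" for b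
  proof (rule linear_maps_eq_on_span[OF _ \<pi>.linear_map_axioms full _ that[unfolded B_def]])
    show "linear_map K F G (\<lambda>b. \<mu> (\<rho> b))"
      by (intro linear_mapI F.module_axioms G.module_axioms linear_maps_comp[OF \<rho>.linear \<mu>.linear])
    show "\<mu> (\<rho> b) = \<pi> b" if "b \<in> F.brackets (carrier F)" for b
      using in_B[OF that] by (auto simp: \<rho>_br \<mu>_pair br \<pi>.closed)
  qed
  have \<theta>\<rho>: "\<theta> (\<rho> b) = ?q b" if "b \<in> B" for b
  proof (rule linear_maps_eq_on_span[OF _ q.coset_map full _ that[unfolded B_def]])
    show "linear_map K F (quot_module F C) (\<lambda>b. \<theta> (\<rho> b))"
      by (intro linear_mapI F.module_axioms q.quot_module linear_maps_comp[OF \<rho>.linear \<theta>.linear])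
    show "\<theta> (\<rho> b) = ?q b" if "b \<in> F.brackets (carrier F)" for b
      using in_B[OF that] by (auto simp: \<rho>_br \<theta>_pair f \<pi>.closed)
  qed
  have "C \<subseteq> {x \<in> carrier F. \<rho> x \<in> {\<zero>\<^bsub>?Q\<^esub>}}"
    unfolding C_def
  proof (rule F.linear_span_minimal[OF \<rho>.submodule_vimage[OF Q.submodule_zero]])
    show "F.brackets I \<subseteq> {x \<in> carrier F. \<rho> x \<in> {\<zero>\<^bsub>?Q\<^esub>}}"
      using zero_pair by (auto simp: F.brackets_def I_def F.bracket_closed \<rho>_br \<pi>.closed)
  qed
  then have \<rho>_C: "\<rho> c = \<zero>\<^bsub>?Q\<^esub>" if "c \<in> C" for c using that by blast
  have ker: "\<rho> b = \<zero>\<^bsub>?Q\<^esub> \<longleftrightarrow> ?q b = C" if b: "b \<in> B" for b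
  proof
    assume "\<rho> b = \<zero>\<^bsub>?Q\<^esub>"
    then show "?q b = C" using \<theta>\<rho>[OF b] \<theta>.hom_zero by simp
  next
    assume "?q b = C"
    then have "b \<in> C" using b B_sub q.coset_eq_zero_iff by blast
    then show "\<rho> b = \<zero>\<^bsub>?Q\<^esub>" by (rule \<rho>_C)
  qed
  have \<rho>_onto: "carrier ?Q \<subseteq> \<rho> ` B"
  proof (rule G.leibniz_square_spanned[OF \<rho>.submodule_image[OF B]])
    fix x y assume "x \<in> carrier G" "y \<in> carrier G"
    then obtain a b where "a \<in> carrier F" "b \<in> carrier F" "x = \<pi> a" "y = \<pi> b" using surj by blast
    then show "G.pair x y \<in> \<rho> ` B" using \<rho>_br br_B by (metis imageI)
  qed

  \<comment> \<open>\<open>I \<inter> B\<close> covers both sides, through \<open>\<rho>\<close> and through the projection modulo \<open>C\<close>.\<close>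
  let ?A = "F\<lparr>carrier := I \<inter> B\<rparr>"
  let ?Z = "{X \<in> carrier ?Q. \<mu> X = \<zero>\<^bsub>G\<^esub>}"
  let ?M = "quot_hom_space F C"
  have IB: "submodule (I \<inter> B) K F" by (rule F.submodule_Int[OF I B])
  have A: "hom_vector_space K ?A" by (rule F.restrict[OF IB]) (use tI tB in auto)
  have \<rho>_img: "\<rho> ` (I \<inter> B) = ?Z"
  proof
    show "\<rho> ` (I \<inter> B) \<subseteq> ?Z" using \<mu>\<rho> B_sub by (auto simp: I_def \<rho>.closed)
    show "?Z \<subseteq> \<rho> ` (I \<inter> B)"
    proof
      fix X assume X: "X \<in> ?Z"
      then obtain b where b: "b \<in> B" "X = \<rho> b" using \<rho>_onto by blast
      then have "b \<in> I" using X \<mu>\<rho> B_sub by (auto simp: I_def)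
      then show "X \<in> \<rho> ` (I \<inter> B)" using b by blast
    qed
  qed
  have HL: "HL K G 2 = ?Q\<lparr>carrier := \<rho> ` (I \<inter> B)\<rparr>"
    unfolding \<rho>_img by (rule G.HL_2_eq[OF \<mu> \<mu>_pair])
  have S: "schur_multiplier K F (\<iota> ` carrier R) = ?M\<lparr>carrier := ?q ` (I \<inter> B)\<rparr>"
    unfolding schur_multiplier_def \<iota>R comm_B comm_C by (rule quot_hom_space_restrict)
  have q_hom: "?q \<in> hom_space_homs K F ?M" by (rule F.coset_hom[OF C tC])
  have M: "hom_vector_space K ?M" by (rule F.quot_hom_space[OF C tC])
  interpret qM: linear_map K F ?M ?q by (rule linear_map_hom_spaces[OF F.hom_vector_space_axioms M q_hom])
  have t_IB: "twist F x \<in> I \<inter> B" if "x \<in> I \<inter> B" for x using that tI tB by blast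
  have image: "hom_vector_space K (?Q\<lparr>carrier := \<rho> ` (I \<inter> B)\<rparr>)"
    "\<rho> \<in> hom_space_homs K ?A (?Q\<lparr>carrier := \<rho> ` (I \<inter> B)\<rparr>)"
    by (rule F.image_hom_vector_space F.restrict_hom; rule IB t_IB Q.hom_vector_space_axioms \<rho>; assumption?)+
  have image': "hom_vector_space K (?M\<lparr>carrier := ?q ` (I \<inter> B)\<rparr>)"
    "?q \<in> hom_space_homs K ?A (?M\<lparr>carrier := ?q ` (I \<inter> B)\<rparr>)"
    by (rule F.image_hom_vector_space F.restrict_hom; rule IB t_IB M q_hom; assumption?)+
  show ?thesis
    unfolding HL S
  proof (rule hom_space_iso_of_common_cover[OF A, of _ _ \<rho> ?q])
    fix x assume "x \<in> carrier ?A"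
    then show "\<rho> x = \<zero>\<^bsub>?Q\<lparr>carrier := \<rho> ` (I \<inter> B)\<rparr>\<^esub> \<longleftrightarrow> ?q x = \<zero>\<^bsub>?M\<lparr>carrier := ?q ` (I \<inter> B)\<rparr>\<^esub>"
      using ker[of x] by simp
  qed (simp_all add: image image')
qed

end
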